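(* Let $T$ be a tree with $n$ vertices, labelled by non-empty pairwise disjoint sets $X_1,\dots,X_n$, let $E=X_1\cup\dots\cup X_n$, and let $M$ be a matroid with ground set $E$. For each edge $e$ of $T$, let $(Y_e,Z_e)$ be the partition of $E$ induced by $e$, i.e. $Y_e$ and $Z_e$ are the unions of the labels of the vertices in the two components of $T-e$. Suppose that, for every edge $e$ of $T$, $(Y_e,Z_e)$ is an exact $3$-separation of $M$ and there are $Y_e$-strands $Y_{e1},\dots,Y_{em_e}$ and $Z_e$-strands $Z_{e1},\dots,Z_{em_e}$ (with respect to $(Y_e,Z_e)$) such that, for each $k\in\{1,\dots,m_e\}$, $\sqcap(Y_{ek},Z_{ek})=1$ and $M$ has an extension by an element $p_{ek}$ in which $Y_{ek}\cup p_{ek}$ and $Z_{ek}\cup p_{ek}$ are circuits. Then $M$ can be extended by the set $\bigcup_{e\in E(T)}\{p_{e1},\dots,p_{em_e}\}$ of new elements to a matroid $M'$ in which $Y_{ek}\cup p_{ek}$ and $Z_{ek}\cup p_{ek}$ are circuits for all edges $e$ of $T$ and all $k\in\{1,\dots,m_e\}$. Moreover, $M'$ is unique.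
   Context: For subsets $U,V$ of the ground set of a matroid with rank function $r$, $\sqcap(U,V)=r(U)+r(V)-r(U\cup V)$. A partition $(A,B)$ of the ground set is an exact $3$-separation if $|A|,|B|\ge 3$ and $r(A)+r(B)-r(M)=2$. For such a separation, an $A$-strand is a minimal subset $A'\subseteq A$ with $\sqcap(A',B)=1$, and a $B$-strand is a minimal subset $B'\subseteq B$ with $\sqcap(B',A)=1$. An extension of $M$ by new elements $P$ is a matroid $M'$ on $E\cup P$ with $M'\backslash P=M$. *)

theory Defs
  imports Main "HOL-Library.Disjoint_Sets"
begin

section \<open>Finite matroids\<close>

record 'a matroid =
  ground :: "'a set"
  indeps :: "'a set set"

locale matroid =
  fixes M :: "'a matroid"
  assumes finite_ground: "finite (ground M)"
    and indeps_subset: "I \<in> indeps M \<Longrightarrow> I \<subseteq> ground M"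
    and empty_indep: "{} \<in> indeps M"
    and indep_mono: "I \<in> indeps M \<Longrightarrow> J \<subseteq> I \<Longrightarrow> J \<in> indeps M"
    and augment: "I \<in> indeps M \<Longrightarrow> J \<in> indeps M \<Longrightarrow> card I < card J \<Longrightarrow>
      \<exists>x \<in> J - I. insert x I \<in> indeps M"

definition circuit :: "'a matroid \<Rightarrow> 'a set \<Rightarrow> bool" where
  "circuit M C \<longleftrightarrow> C \<subseteq> ground M \<and> C \<notin> indeps M \<and> (\<forall>D. D \<subset> C \<longrightarrow> D \<in> indeps M)"

definition rank :: "'a matroid \<Rightarrow> 'a set \<Rightarrow> nat" where
  "rank M U = Max (card ` {I \<in> indeps M. I \<subseteq> U})"

definition delete :: "'a matroid \<Rightarrow> 'a set \<Rightarrow> 'a matroid" where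
  "delete M P = \<lparr>ground = ground M - P, indeps = {I \<in> indeps M. I \<inter> P = {}}\<rparr>"

text \<open>\<open>extension M P N\<close>: \<open>N\<close> is an extension of \<open>M\<close> by the set \<open>P\<close> of new elements.\<close>

definition extension :: "'a matroid \<Rightarrow> 'a set \<Rightarrow> 'a matroid \<Rightarrow> bool" where
  "extension M P N \<longleftrightarrow> P \<inter> ground M = {} \<and> matroid N \<and> ground N = ground M \<union> P \<and> delete N P = M"

text \<open>Local connectivity; integer-valued, since natural subtraction would truncate.\<close>

definition local_conn :: "'a matroid \<Rightarrow> 'a set \<Rightarrow> 'a set \<Rightarrow> int" where
  "local_conn M U V = int (rank M U) + int (rank M V) - int (rank M (U \<union> V))"

definition exact_3_separation :: "'a matroid \<Rightarrow> 'a set \<Rightarrow> 'a set \<Rightarrow> bool" where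
  "exact_3_separation M A B \<longleftrightarrow> A \<union> B = ground M \<and> A \<inter> B = {} \<and> card A \<ge> 3 \<and> card B \<ge> 3 \<and>
     int (rank M A) + int (rank M B) - int (rank M (ground M)) = 2"

text \<open>\<open>strand M A B S\<close>: \<open>S\<close> is an \<open>A\<close>-strand with respect to the separation \<open>(A, B)\<close>;
  the \<open>B\<close>-strands are given by \<open>strand M B A\<close>.\<close>

definition strand :: "'a matroid \<Rightarrow> 'a set \<Rightarrow> 'a set \<Rightarrow> 'a set \<Rightarrow> bool" where
  "strand M A B S \<longleftrightarrow> S \<subseteq> A \<and> local_conn M S B = 1 \<and> (\<forall>S'. S' \<subset> S \<longrightarrow> local_conn M S' B \<noteq> 1)"


section \<open>Trees\<close>

record 'v ugraph =
  nodes :: "'v set"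
  edges :: "'v set set"

definition simple_graph :: "'v ugraph \<Rightarrow> bool" where
  "simple_graph T \<longleftrightarrow> finite (nodes T) \<and> (\<forall>e \<in> edges T. e \<subseteq> nodes T \<and> card e = 2)"

definition connected_in :: "'v ugraph \<Rightarrow> ('v \<times> 'v) set" where
  "connected_in T = {(u, v). u \<in> nodes T \<and> v \<in> nodes T \<and> (u, v) \<in> {(x, y). {x, y} \<in> edges T}\<^sup>*}"

definition components :: "'v ugraph \<Rightarrow> 'v set set" where
  "components T = nodes T // connected_in T"

definition cycle :: "'v ugraph \<Rightarrow> 'v list \<Rightarrow> bool" where
  "cycle T c \<longleftrightarrow> length c \<ge> 3 \<and> distinct c \<and>
     (\<forall>i < length c. {c ! i, c ! (Suc i mod length c)} \<in> edges T)"

definition tree :: "'v ugraph \<Rightarrow> bool" where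
  "tree T \<longleftrightarrow> simple_graph T \<and> nodes T \<noteq> {} \<and>
     (\<forall>u \<in> nodes T. \<forall>v \<in> nodes T. (u, v) \<in> connected_in T) \<and> (\<nexists>c. cycle T c)"

definition delete_edge :: "'v ugraph \<Rightarrow> 'v set \<Rightarrow> 'v ugraph" where
  "delete_edge T e = \<lparr>nodes = nodes T, edges = edges T - {e}\<rparr>"

text \<open>The pair \<open>(A, B)\<close> is the partition induced by the edge \<open>e\<close> of the tree \<open>T\<close> with vertex
  labels \<open>X\<close>. The two components of \<open>T - e\<close> carry no canonical order, so \<open>(B, A)\<close> is then
  induced as well.\<close>

definition induced_partition ::
    "'v ugraph \<Rightarrow> ('v \<Rightarrow> 'a set) \<Rightarrow> 'v set \<Rightarrow> 'a set \<Rightarrow> 'a set \<Rightarrow> bool" where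
  "induced_partition T X e A B \<longleftrightarrow>
     (\<exists>C D. C \<noteq> D \<and> components (delete_edge T e) = {C, D} \<and> A = \<Union> (X ` C) \<and> B = \<Union> (X ` D))"

end

(*
  If q lies in the span of both Y and Z, where (C, D) is an exact 3-separation and Y, Z have
  connectivity 1 to each other and to the opposite sides, then submodularity decides for every
  set F whether q lies in its span: with F1 and F2 the parts of F in C and D, this happens iff F1
  meets Z in the guts, or F2 meets Y in the guts, or F1 and F2 meet the guts in two distinct
  points. Hence a one-point extension is unique, and this prescription defines a modular cut
  exactly when "meeting the guts in the same point" is transitive (coherence). Coherence of
  another, noncrossing separation survives the addition of q: in the extension, the set F1 + q is
  indistinguishable, from the far side, from some set of old elements. Since the separations
  displayed by the edges of a tree are pairwise noncrossing, the points can be added one by one.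
*)
theory Submission
  imports Defs
begin

section \<open>Rank and local connectivity\<close>

text \<open>The guts of an exact 3-separation (C, D) behave like a line: for F inside C,
  \<open>local_conn M F D\<close>, which is 0, 1 or 2, tells whether F meets nothing of it, one
  point or all of it. The points of this line need not be elements of the matroid, so every
  statement about them is made through local connectivity, and the inequality
  \<open>local_conn_marginal\<close> replaces the geometry. The obstacle to adding the points in
  turn is that an extension of M by a later point alone says nothing directly about a matroid that
  already contains the earlier points. The assumed extensions therefore serve only to derive
  \<open>coherent\<close>, a condition on connectivities of subsets of the two sides; this
  condition, together with the strands, is what the induction carries. A new point must also be
  assigned to a side of every remaining separation without creating crossings. The rule
  \<open>grow\<close> looks at one side at a time and is monotone in it, so containments between
  sides survive. The whole setting is symmetric under exchanging C, Y with D, Z, which the swap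
  lemmas exploit.\<close>

lemma local_conn_commute: "local_conn M U V = local_conn M V U"
  unfolding local_conn_def by (simp add: Un_commute)

context matroid
begin

lemma finite_indep: "I \<in> indeps M \<Longrightarrow> finite I"
  using finite_ground indeps_subset finite_subset by blast

lemma finite_indeps_below: "finite {I \<in> indeps M. I \<subseteq> U}"
proof -
  have "{I \<in> indeps M. I \<subseteq> U} \<subseteq> Pow (ground M)" using indeps_subset by auto
  then show ?thesis using finite_ground finite_subset by blast
qed

lemma card_le_rank: "I \<in> indeps M \<Longrightarrow> I \<subseteq> U \<Longrightarrow> card I \<le> rank M U"
  unfolding rank_def using finite_indeps_below[of U] by (intro Max_ge) auto

lemma rank_witness: "\<exists>I \<in> indeps M. I \<subseteq> U \<and> card I = rank M U"
proof -
  have "{I \<in> indeps M. I \<subseteq> U} \<noteq> {}" using empty_indep by auto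
  then have "rank M U \<in> card ` {I \<in> indeps M. I \<subseteq> U}"
    unfolding rank_def using finite_indeps_below[of U] by (intro Max_in) auto
  then show ?thesis by auto
qed

lemma basis_extend:
  assumes "I \<in> indeps M" "I \<subseteq> U"
  shows "\<exists>J \<in> indeps M. I \<subseteq> J \<and> J \<subseteq> U \<and> card J = rank M U"
proof -
  let ?S = "{J \<in> indeps M. I \<subseteq> J \<and> J \<subseteq> U}"
  have fin: "finite ?S" by (rule finite_subset[OF _ finite_indeps_below[of U]]) auto
  have "I \<in> ?S" using assms by auto
  then have "Max (card ` ?S) \<in> card ` ?S" using fin by (intro Max_in) auto
  then obtain J where J: "J \<in> ?S" "card J = Max (card ` ?S)" by auto
  then have max: "card K \<le> card J" if "K \<in> ?S" for K
    using fin that by (simp add: Max_ge)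
  have "card J = rank M U"
  proof (rule ccontr)
    assume "card J \<noteq> rank M U"
    then have less: "card J < rank M U" using card_le_rank[of J U] J by auto
    obtain B where B: "B \<in> indeps M" "B \<subseteq> U" "card B = rank M U" using rank_witness by blast
    then obtain x where "x \<in> B - J" "insert x J \<in> indeps M" using augment[of J B] J less by auto
    then have "insert x J \<in> ?S" "card (insert x J) = Suc (card J)"
      using J B finite_indep[of J] by auto
    then show False using max by fastforce
  qed
  then show ?thesis using J by auto
qed

lemma rank_mono: "U \<subseteq> V \<Longrightarrow> rank M U \<le> rank M V"
proof -
  assume "U \<subseteq> V"
  moreover obtain I where "I \<in> indeps M" "I \<subseteq> U" "card I = rank M U" using rank_witness by blast
  ultimately show ?thesis using card_le_rank[of I V] by auto
qed

lemma rank_le_card: "finite U \<Longrightarrow> rank M U \<le> card U"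
proof -
  assume "finite U"
  moreover obtain I where "I \<subseteq> U" "card I = rank M U" using rank_witness by blast
  ultimately show ?thesis using card_mono[of U I] by simp
qed

lemma rank_indep: "I \<in> indeps M \<Longrightarrow> rank M I = card I"
  using card_le_rank[of I I] rank_le_card[of I] finite_indep[of I] by simp

lemma indep_if_rank: "finite U \<Longrightarrow> rank M U = card U \<Longrightarrow> U \<in> indeps M"
proof -
  assume "finite U" "rank M U = card U"
  moreover obtain I where "I \<in> indeps M" "I \<subseteq> U" "card I = rank M U" using rank_witness by blast
  ultimately show ?thesis using card_subset_eq[of U I] by simp
qed

lemma rank_empty: "rank M {} = 0"
  using rank_indep[OF empty_indep] by simp

lemma rank_submodular: "rank M (U \<union> V) + rank M (U \<inter> V) \<le> rank M U + rank M V"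
proof -
  obtain I where I: "I \<in> indeps M" "I \<subseteq> U \<inter> V" "card I = rank M (U \<inter> V)"
    using rank_witness by blast
  obtain K where K: "K \<in> indeps M" "I \<subseteq> K" "K \<subseteq> U \<union> V" "card K = rank M (U \<union> V)"
    using basis_extend[of I "U \<union> V"] I by blast
  have fin: "finite K" using finite_indep K by auto
  have "card K + card (K \<inter> U \<inter> V) = card (K \<inter> U) + card (K \<inter> V)"
  proof -
    have "(K \<inter> U) \<union> (K \<inter> V) = K" "(K \<inter> U) \<inter> (K \<inter> V) = K \<inter> U \<inter> V" using K by auto
    then show ?thesis using card_Un_Int[of "K \<inter> U" "K \<inter> V"] fin by simp
  qed
  moreover have "card I \<le> card (K \<inter> U \<inter> V)" using I K fin by (intro card_mono) auto
  moreover have "card (K \<inter> U) \<le> rank M U" "card (K \<inter> V) \<le> rank M V"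
    using K indep_mono by (auto intro!: card_le_rank)
  ultimately show ?thesis using I K by linarith
qed

lemma rank_submodular': "W \<subseteq> U \<inter> V \<Longrightarrow> rank M (U \<union> V) + rank M W \<le> rank M U + rank M V"
  using rank_submodular[of U V] rank_mono[of W "U \<inter> V"] by linarith

lemma rank_insert_le: "rank M (insert x U) \<le> rank M U + 1"
  using rank_submodular'[of "{}" U "{x}"] rank_le_card[of "{x}"] by (simp add: rank_empty)

lemma rank_insert_eq_mono:
  assumes "rank M (insert x U) = rank M U" "U \<subseteq> V"
  shows "rank M (insert x V) = rank M V"
proof -
  have "insert x U \<union> V = insert x V" using assms by auto
  then have "rank M (insert x V) + rank M U \<le> rank M (insert x U) + rank M V"
    using rank_submodular'[of U "insert x U" V] assms by auto
  moreover have "rank M V \<le> rank M (insert x V)" by (rule rank_mono) auto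
  ultimately show ?thesis using assms by linarith
qed

lemma rank_Un_eq:
  assumes "finite V" "\<And>x. x \<in> V \<Longrightarrow> rank M (insert x U) = rank M U"
  shows "rank M (U \<union> V) = rank M U"
  using assms
proof (induction V)
  case (insert x V)
  have "rank M (insert x (U \<union> V)) = rank M (U \<union> V)"
    by (rule rank_insert_eq_mono[of x U]) (rule insert.prems, auto)
  moreover have "rank M (U \<union> V) = rank M U" by (rule insert.IH) (rule insert.prems, simp)
  ultimately show ?case by simp
qed simp

lemma local_conn_nonneg: "0 \<le> local_conn M U V"
  using rank_submodular[of U V] unfolding local_conn_def by linarith

text \<open>Supermodularity: the terms r(U') - r(U) cancel, and submodularity of the rank on U'
  \<union> V and U \<union> V' remains. With U' a whole side of a separation, it says that a set
  attaining the full connectivity 2 acts on every smaller V as the whole side does.\<close>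

lemma local_conn_marginal:
  assumes "U \<subseteq> U'" "V \<subseteq> V'"
  shows "local_conn M U' V - local_conn M U V \<le> local_conn M U' V' - local_conn M U V'"
proof -
  have "(U' \<union> V) \<union> (U \<union> V') = U' \<union> V'" using assms by auto
  then show ?thesis
    using rank_submodular'[of "U \<union> V" "U' \<union> V" "U \<union> V'"] assms
    unfolding local_conn_def by fastforce
qed

lemma local_conn_mono_left: "U \<subseteq> U' \<Longrightarrow> local_conn M U V \<le> local_conn M U' V"
  using local_conn_marginal[of U U' "{}" V] unfolding local_conn_def by (simp add: rank_empty)

lemma local_conn_mono: "U \<subseteq> U' \<Longrightarrow> V \<subseteq> V' \<Longrightarrow> local_conn M U V \<le> local_conn M U' V'"
  using local_conn_mono_left local_conn_commute by (metis order_trans)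

lemma local_conn_insert_left:
  assumes "rank M (insert x U) = rank M U"
  shows "local_conn M (insert x U) V = local_conn M U V"
  using rank_insert_eq_mono[OF assms, of "U \<union> V"] assms unfolding local_conn_def by simp

end

section \<open>Single-element extensions\<close>

text \<open>Crapo's single-element extension: \<open>Q\<close> is read as "q lies in the
  span".\<close>

definition cut_extension :: "'a matroid \<Rightarrow> ('a set \<Rightarrow> bool) \<Rightarrow> 'a \<Rightarrow> 'a matroid" where
  "cut_extension M Q q =
     \<lparr>ground = insert q (ground M), indeps = indeps M \<union> insert q ` {I \<in> indeps M. \<not> Q I}\<rparr>"

text \<open>A modular cut, presented by the family \<open>Q\<close> of sets whose closure belongs to it; it
  suffices to test modular pairs that cover a common set.\<close>

locale modular_cut = matroid +
  fixes Q :: "'a set \<Rightarrow> bool"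
  assumes Q_insert: "U \<subseteq> ground M \<Longrightarrow> x \<in> ground M \<Longrightarrow> Q U \<Longrightarrow> Q (insert x U)"
    and Q_closure: "U \<subseteq> ground M \<Longrightarrow> x \<in> ground M \<Longrightarrow> rank M (insert x U) = rank M U \<Longrightarrow>
      Q (insert x U) \<Longrightarrow> Q U"
    and Q_modular: "U \<subseteq> ground M \<Longrightarrow> a \<in> ground M \<Longrightarrow> b \<in> ground M \<Longrightarrow>
      rank M (insert a (insert b U)) = rank M U + 2 \<Longrightarrow>
      Q (insert a U) \<Longrightarrow> Q (insert b U) \<Longrightarrow> Q U"
begin

lemma Q_mono:
  assumes "Q U" "U \<subseteq> V" "V \<subseteq> ground M"
  shows "Q V"
proof -
  have "finite W \<Longrightarrow> W \<subseteq> ground M \<Longrightarrow> Q (W \<union> U)" for W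
  proof (induction W rule: finite_induct)
    case (insert x W)
    then show ?case using Q_insert[of "W \<union> U" x] assms by auto
  qed (use assms in simp)
  from this[of V] show ?thesis using assms finite_ground finite_subset by (metis Un_absorb2)
qed

lemma Q_span:
  assumes "Q V" "U \<subseteq> V" "V \<subseteq> ground M" "rank M V = rank M U"
  shows "Q U"
proof -
  have "finite W \<Longrightarrow> W \<subseteq> V \<Longrightarrow> Q (W \<union> U) \<Longrightarrow> Q U" for W
  proof (induction W rule: finite_induct)
    case (insert x W)
    have "rank M (insert x (W \<union> U)) \<le> rank M V" "rank M U \<le> rank M (W \<union> U)"
      "rank M (W \<union> U) \<le> rank M (insert x (W \<union> U))"
      using insert.prems assms by (intro rank_mono; auto)+
    then have "rank M (insert x (W \<union> U)) = rank M (W \<union> U)" using assms by linarith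
    moreover have "W \<union> U \<subseteq> ground M" "x \<in> ground M" using insert.prems assms by auto
    ultimately have "Q (W \<union> U)" using Q_closure[of "W \<union> U" x] insert.prems by simp
    then show ?case using insert by auto
  qed simp
  from this[of V] show ?thesis using assms finite_ground finite_subset by (metis Un_absorb2 order_refl)
qed

text \<open>The augmentation axiom for two sets in the extension, the first containing q. If every
  augmentation of I fell into the cut, two that together raise the rank by 2 would form a modular
  pair and put I itself into the cut. So J lies in the span of a single augmentation I + x; then J
  has the same size and the same span, and inherits \<open>Q\<close> from it.\<close>

lemma augment_outside:
  assumes I: "I \<in> indeps M" "\<not> Q I" and J: "J \<in> indeps M"
    and card: "card I < card J" "\<not> Q J \<or> card I + 1 < card J"
  shows "\<exists>x \<in> J - I. insert x I \<in> indeps M \<and> \<not> Q (insert x I)"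
proof (rule ccontr)
  assume "\<not> ?thesis"
  then have all: "Q (insert x I)" if "x \<in> J - I" "insert x I \<in> indeps M" for x using that by auto
  obtain x where x: "x \<in> J - I" "insert x I \<in> indeps M" using augment[OF I(1) J card(1)] by auto
  let ?B = "insert x I"
  have finI: "finite I" and finJ: "finite J" using finite_indep I J by auto
  have sub: "I \<subseteq> ground M" "J \<subseteq> ground M" using indeps_subset I J by auto
  have rB: "rank M ?B = card I + 1" using rank_indep[OF x(2)] x finI by simp
  have "rank M (insert y ?B) = rank M ?B" if y: "y \<in> J" for y
  proof (rule ccontr)
    assume "rank M (insert y ?B) \<noteq> rank M ?B"
    then have r: "rank M (insert y ?B) = card I + 2"
      using rank_insert_le[of y ?B] rank_mono[of ?B "insert y ?B"] rB by fastforce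
    have "y \<notin> ?B" using r rB by (auto simp: insert_absorb)
    then have "insert y ?B \<in> indeps M" using r x finI by (intro indep_if_rank) auto
    then have "insert y I \<in> indeps M" by (rule indep_mono) auto
    then have "Q (insert y I)" using all y \<open>y \<notin> ?B\<close> by auto
    then have "Q I" using Q_modular[of I y x] r rank_indep[OF I(1)] all[OF x] sub x y by auto
    then show False using I by simp
  qed
  then have rJ: "rank M (?B \<union> J) = card I + 1" using rank_Un_eq[OF finJ, of ?B] rB by auto
  then have cJ: "card J \<le> card I + 1" using card_le_rank[OF J, of "?B \<union> J"] by auto
  then have "\<not> Q J" using card by auto
  moreover have "Q (?B \<union> J)" using Q_mono[OF all[OF x]] sub x by auto
  moreover have "rank M (?B \<union> J) = rank M J" using rJ rank_indep[OF J] cJ card by linarith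
  ultimately show False using Q_span[of "?B \<union> J" J] sub x by auto
qed

lemma matroid_cut_extension:
  assumes q: "q \<notin> ground M"
  shows "matroid (cut_extension M Q q)"
proof
  let ?N = "cut_extension M Q q"
  have qi: "q \<notin> I" if "I \<in> indeps M" for I using that indeps_subset q by auto
  have iff0: "I \<in> indeps ?N \<longleftrightarrow> I \<in> indeps M" if "q \<notin> I" for I
    using that by (auto simp: cut_extension_def)
  have iff1: "insert q I \<in> indeps ?N \<longleftrightarrow> I \<in> indeps M \<and> \<not> Q I" if "q \<notin> I" for I
    using that qi by (auto simp: cut_extension_def image_iff dest: insert_ident[THEN iffD1, rotated 2])
  have split: "insert q (I - {q}) = I" if "q \<in> I" for I using that by auto
  show "finite (ground ?N)" using finite_ground by (simp add: cut_extension_def)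
  show "I \<subseteq> ground ?N" if "I \<in> indeps ?N" for I
    using that indeps_subset by (auto simp: cut_extension_def)
  show "{} \<in> indeps ?N" using empty_indep iff0 by simp
  show "J \<in> indeps ?N" if "I \<in> indeps ?N" "J \<subseteq> I" for I J
  proof (cases "q \<in> I")
    case False
    then show ?thesis using that iff0[of I] iff0[of J] indep_mono by blast
  next
    case True
    let ?I = "I - {q}" and ?J = "J - {q}"
    have I: "?I \<in> indeps M" "\<not> Q ?I" using iff1[of ?I] split[OF True] that by auto
    have J: "?J \<in> indeps M" using indep_mono[OF I(1), of ?J] that by auto
    have "\<not> Q ?J" using Q_mono[of ?J ?I] I indeps_subset[OF I(1)] that by auto
    then show ?thesis using J iff0[of J] iff1[of ?J] split[of J] by (cases "q \<in> J") simp_all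
  qed
  show "\<exists>x \<in> J - I. insert x I \<in> indeps ?N"
    if IJ: "I \<in> indeps ?N" "J \<in> indeps ?N" "card I < card J" for I J
  proof -
    let ?I = "I - {q}" and ?J = "J - {q}"
    have I: "?I \<in> indeps M" "q \<in> I \<Longrightarrow> \<not> Q ?I" 
      using iff0[of I] iff1[of ?I] split[of I] IJ by (cases "q \<in> I"; simp)+
    have J: "?J \<in> indeps M" "q \<in> J \<Longrightarrow> \<not> Q ?J"
      using iff0[of J] iff1[of ?J] split[of J] IJ by (cases "q \<in> J"; simp)+
    have fin: "finite ?I" "finite ?J" using finite_indep[OF I(1)] finite_indep[OF J(1)] by auto
    have cI: "q \<in> I \<Longrightarrow> card I = card ?I + 1"
      using card_Suc_Diff1[of I q] fin by auto
    have cJ: "q \<in> J \<Longrightarrow> card J = card ?J + 1" "q \<notin> J \<Longrightarrow> ?J = J"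
      using card_Suc_Diff1[of J q] fin by auto
    show ?thesis
    proof (cases "q \<in> I")
      case True
      \<comment> \<open>If q is in both sets, removing it preserves the gap and J - q is outside the
        cut; if q is only in I, the gap grows to at least 2. These are the two alternatives of
        \<open>augment_outside\<close>.\<close>
      have "card ?I < card ?J \<and> (\<not> Q ?J \<or> card ?I + 1 < card ?J)"
      proof (cases "q \<in> J")
        case qJ: True
        then show ?thesis using cI[OF True] cJ(1)[OF qJ] J(2)[OF qJ] IJ(3) by linarith
      next
        case qJ: False
        then show ?thesis using cI[OF True] cJ(2)[OF qJ] IJ(3) by presburger
      qed
      then obtain x where x: "x \<in> ?J - ?I" "insert x ?I \<in> indeps M" "\<not> Q (insert x ?I)"
        using augment_outside[of ?I ?J] I J True by blast
      have "insert x I = insert q (insert x ?I)" using True by auto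
      then have "insert x I \<in> indeps ?N" using iff1[of "insert x ?I"] x by auto
      then show ?thesis using x by auto
    next
      case False
      then have II: "?I = I" by auto
      show ?thesis
      proof (cases "card I < card ?J")
        case True
        then obtain x where "x \<in> ?J - I" "insert x I \<in> indeps M" using augment[of I ?J] I J II by auto
        then show ?thesis using iff0[of "insert x I"] False by auto
      next
        case less: False
        then have qJ: "q \<in> J" using cJ(2) IJ(3) by metis
        then have card: "card ?J = card I" using cJ(1) IJ(3) less by linarith
        show ?thesis
        proof (cases "Q I")
          case False
          \<comment> \<open>Here the augmenting element is q itself.\<close>
          then show ?thesis using iff1[of I] I II \<open>q \<notin> I\<close> qJ by auto
        next
          case True
          have sub: "I \<subseteq> ground M" "?J \<subseteq> ground M" using I J indeps_subset II by auto
          \<comment> \<open>J - q and I have equal size. Were J - q in the span of I, the two would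
            span the same flat, and \<open>Q\<close> would pass from I to J - q.\<close>
          have "\<exists>x \<in> ?J. rank M (insert x I) \<noteq> rank M I"
          proof (rule ccontr)
            assume "\<not> ?thesis"
            then have "rank M (I \<union> ?J) = rank M ?J"
              using rank_Un_eq[OF fin(2), of I] rank_indep I J II card by auto
            moreover have "Q (I \<union> ?J)" using Q_mono[OF True] sub by auto
            ultimately show False using Q_span[of "I \<union> ?J" ?J] J qJ sub by auto
          qed
          then obtain x where x: "x \<in> ?J" "rank M (insert x I) \<noteq> rank M I" by auto
          then have xI: "x \<notin> I" by (auto simp: insert_absorb)
          have "rank M (insert x I) = card I + 1"
            using x rank_insert_le[of x I] rank_mono[of I "insert x I"] rank_indep I II by fastforce
          then have "insert x I \<in> indeps M" using xI fin II by (intro indep_if_rank) auto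
          then show ?thesis using iff0[of "insert x I"] \<open>q \<notin> I\<close> x xI by auto
        qed
      qed
    qed
  qed
qed

end

context matroid
begin

abbreviation conn where "conn \<equiv> local_conn M"

text \<open>Used with W = {q}: a nonloop lying in both spans forces connectivity at least 1.\<close>

lemma rank_Int_le_conn: "W \<subseteq> U \<inter> V \<Longrightarrow> int (rank M W) \<le> conn U V"
  using rank_submodular'[of W U V] unfolding local_conn_def by linarith

lemma conn_empty: "conn {} V = 0" "conn U {} = 0"
  unfolding local_conn_def by (simp_all add: rank_empty)

lemma conn_insert_right:
  "rank M (insert x V) = rank M V \<Longrightarrow> conn U (insert x V) = conn U V"
  using local_conn_insert_left[of x V U] by (simp add: local_conn_commute)

lemma rank_insert_cases: "rank M (insert x U) = rank M U \<or> rank M (insert x U) = rank M U + 1"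
  using rank_insert_le[of x U] rank_mono[OF subset_insertI, of U x] by linarith

lemma conn_insert_le: "conn (insert x U) V \<le> conn U V + 1"
proof -
  have "rank M (U \<union> V) \<le> rank M (insert x U \<union> V)" by (rule rank_mono) auto
  then show ?thesis using rank_insert_le[of x U] unfolding local_conn_def by linarith
qed

lemma conn_marginal_right:
  assumes "U \<subseteq> U'" "V \<subseteq> V'"
  shows "conn U V' - conn U V \<le> conn U' V' - conn U' V"
  using local_conn_marginal[OF assms(2,1)] by (simp add: local_conn_commute)

end

section \<open>Points in the guts of a separation\<close>

text \<open>Call \<open>F \<subseteq> C\<close> and \<open>K \<subseteq> D\<close> parallel if \<open>local_conn M F K = 1\<close>. Coherence asks that two
  parallelisms among \<open>F, Z\<close>, \<open>Y, K\<close> and \<open>F, K\<close> force the third. It holds if and only if a point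
  common to \<open>Y\<close> and \<open>Z\<close> can be added; two planes of the Vamos matroid, each spanned by two of its
  four lines, show that it can fail.\<close>

definition coherent :: "'a matroid \<Rightarrow> 'a set \<Rightarrow> 'a set \<Rightarrow> 'a set \<Rightarrow> 'a set \<Rightarrow> bool" where
  "coherent M C D Y Z \<longleftrightarrow> (\<forall>F K. F \<subseteq> C \<longrightarrow> K \<subseteq> D \<longrightarrow> local_conn M F D = 1 \<longrightarrow> local_conn M C K = 1 \<longrightarrow>
     (local_conn M F Z = 1 \<longrightarrow> local_conn M Y K = 1 \<longrightarrow> local_conn M F K = 1) \<and>
     (local_conn M F K = 1 \<longrightarrow> (local_conn M F Z = 1 \<longleftrightarrow> local_conn M Y K = 1)))"

lemma coherent_swap:
  assumes "coherent M C D Y Z"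
  shows "coherent M D C Z Y"
  unfolding coherent_def
proof (intro allI impI)
  fix F K assume "F \<subseteq> D" "K \<subseteq> C" "local_conn M F C = 1" "local_conn M D K = 1"
  then have "(local_conn M K Z = 1 \<longrightarrow> local_conn M Y F = 1 \<longrightarrow> local_conn M K F = 1) \<and>
      (local_conn M K F = 1 \<longrightarrow> (local_conn M K Z = 1 \<longleftrightarrow> local_conn M Y F = 1))"
    using assms unfolding coherent_def local_conn_commute[of M F C] local_conn_commute[of M D K] by blast
  then show "(local_conn M F Y = 1 \<longrightarrow> local_conn M Z K = 1 \<longrightarrow> local_conn M F K = 1) \<and>
      (local_conn M F K = 1 \<longrightarrow> (local_conn M F Y = 1 \<longleftrightarrow> local_conn M Z K = 1))"
    unfolding local_conn_commute[of M F Y] local_conn_commute[of M Z K] local_conn_commute[of M F K]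
    by blast
qed

locale guts = matroid +
  fixes C D Y Z :: "'a set"
  assumes conn_CD: "conn C D = 2"
    and Y_sub: "Y \<subseteq> C" and Z_sub: "Z \<subseteq> D"
    and conn_YD: "conn Y D = 1" and conn_CZ: "conn C Z = 1" and conn_YZ: "conn Y Z = 1"

lemma guts_swap: "guts M C D Y Z \<Longrightarrow> guts M D C Z Y"
  unfolding guts_def guts_axioms_def by (simp add: local_conn_commute)

locale guts_point = guts +
  fixes q :: 'a
  assumes q_Y: "rank M (insert q Y) = rank M Y" and q_Z: "rank M (insert q Z) = rank M Z"
    and q_nonloop: "rank M {q} = 1"

lemma guts_point_swap: "guts_point M C D Y Z q \<Longrightarrow> guts_point M D C Z Y q"
  unfolding guts_point_def guts_point_axioms_def using guts_swap[of M C D Y Z] by simp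

context guts_point
begin

lemma q_C: "C \<subseteq> U \<Longrightarrow> rank M (insert q U) = rank M U"
  and q_D: "D \<subseteq> U \<Longrightarrow> rank M (insert q U) = rank M U"
  using rank_insert_eq_mono[OF q_Y order_trans[OF Y_sub]]
    rank_insert_eq_mono[OF q_Z order_trans[OF Z_sub]] by blast+

text \<open>If q is in the span of F, it is common to the spans of F and Z, so the connectivity is
  at least 1, and \<open>conn C Z = 1\<close> bounds it above. Conversely, q is in the span of F
  \<union> Z already; if it raised r(F), then F + q would have connectivity 2 to Z, more than C
  has.\<close>

lemma span_left_iff:
  assumes "F \<subseteq> C"
  shows "rank M (insert q F) = rank M F \<longleftrightarrow> conn F Z = 1"
proof
  assume "rank M (insert q F) = rank M F"
  then have "conn (insert q F) (insert q Z) = conn F Z"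
    using q_Z by (simp add: local_conn_insert_left conn_insert_right)
  then show "conn F Z = 1"
    using rank_Int_le_conn[of "{q}" "insert q F" "insert q Z"] q_nonloop
      local_conn_mono[OF assms order_refl, of Z] conn_CZ by auto
next
  assume "conn F Z = 1"
  moreover have "rank M (insert q (F \<union> Z)) = rank M (F \<union> Z)" using rank_insert_eq_mono[OF q_Z] by auto
  moreover have "conn (insert q F) Z \<le> 1"
    using local_conn_mono[of "insert q F" "insert q C" Z Z] assms conn_CZ
      local_conn_insert_left[OF q_C[OF order_refl]] by auto
  ultimately show "rank M (insert q F) = rank M F"
    using rank_insert_cases[of q F] unfolding local_conn_def by auto
qed

lemma span_right_iff:
  assumes "K \<subseteq> D"
  shows "rank M (insert q K) = rank M K \<longleftrightarrow> conn Y K = 1"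
proof -
  interpret swap: guts_point M D C Z Y q by (rule guts_point_swap) unfold_locales
  show ?thesis using swap.span_left_iff[OF assms] by (simp add: local_conn_commute)
qed

lemma conn_q_le:
  assumes "F \<subseteq> C" "K \<subseteq> D"
  shows "conn (insert q F) (insert q K) \<le> 2"
proof -
  have "conn (insert q C) (insert q D) = 2"
    using q_C q_D conn_CD by (simp add: local_conn_insert_left conn_insert_right)
  then show ?thesis
    using local_conn_mono[of "insert q F" "insert q C" "insert q K" "insert q D"] assms by auto
qed

text \<open>F and K share the only point in which F meets the guts, and that point is q. If q were
  outside the span of K, then F + q and K + q would have connectivity 2, more than F has to all of
  D.\<close>

lemma span_agree:
  assumes "F \<subseteq> C" "K \<subseteq> D" "conn F D = 1" "conn F K = 1" "rank M (insert q F) = rank M F"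
  shows "rank M (insert q K) = rank M K"
proof (rule ccontr)
  assume "\<not> ?thesis"
  then have K: "rank M (insert q K) = rank M K + 1" using rank_insert_cases by blast
  have "rank M (insert q (F \<union> K)) = rank M (F \<union> K)" using rank_insert_eq_mono assms(5) by auto
  then have "conn (insert q F) (insert q K) = 2"
    using K assms unfolding local_conn_def by simp
  moreover have "conn (insert q F) (insert q K) \<le> conn (insert q F) (insert q D)"
    using assms by (intro local_conn_mono) auto
  moreover have "\<dots> = 1"
    using assms q_D by (simp add: local_conn_insert_left conn_insert_right)
  ultimately show False by linarith
qed

text \<open>Being parallel to Z (for F) or to Y (for K) means having q in the span. A common q gives
  \<open>conn F K\<close> at least 1, and \<open>conn F D = 1\<close> caps it; the equivalence is
  \<open>span_agree\<close> in both directions.\<close>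

lemma coherent: "coherent M C D Y Z"
proof -
  interpret swap: guts_point M D C Z Y q by (rule guts_point_swap) unfold_locales
  show ?thesis
    unfolding coherent_def
  proof (intro allI impI conjI)
    fix F K assume F: "F \<subseteq> C" "conn F D = 1" and K: "K \<subseteq> D" "conn C K = 1"
    { assume "conn F Z = 1" "conn Y K = 1"
      then have "rank M (insert q F) = rank M F" "rank M (insert q K) = rank M K"
        using span_left_iff[OF F(1)] span_right_iff[OF K(1)] by auto
      then have "conn (insert q F) (insert q K) = conn F K"
        by (simp add: local_conn_insert_left conn_insert_right)
      then show "conn F K = 1"
        using rank_Int_le_conn[of "{q}" "insert q F" "insert q K"] q_nonloop
          local_conn_mono[of F F K D] F K by auto }
    assume FK: "conn F K = 1"
    show "conn F Z = 1 \<longleftrightarrow> conn Y K = 1"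
      using span_left_iff[OF F(1)] span_right_iff[OF K(1)] span_agree[of F K] swap.span_agree[of K F]
        F K FK by (auto simp: local_conn_commute)
  qed
qed

text \<open>For the converse, intersecting the spans of \<open>C \<union> K\<close> and \<open>D \<union> F\<close> bounds the rank of
  \<open>F \<union> K \<union> {q}\<close>.\<close>

lemma span_iff:
  assumes F: "F \<subseteq> C" and K: "K \<subseteq> D"
  shows "rank M (insert q (F \<union> K)) = rank M (F \<union> K) \<longleftrightarrow>
    conn F Z = 1 \<or> conn Y K = 1 \<or> (conn F D = 1 \<and> conn C K = 1 \<and> conn F K = 0)"
proof
  assume FK: "rank M (insert q (F \<union> K)) = rank M (F \<union> K)"
  { assume "conn F Z \<noteq> 1" "conn Y K \<noteq> 1"
    then have qF: "rank M (insert q F) = rank M F + 1" and qK: "rank M (insert q K) = rank M K + 1"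
      using span_left_iff[OF F] span_right_iff[OF K] rank_insert_cases by blast+
    \<comment> \<open>q raises the rank of each part but not of their union, so it is counted
      twice.\<close>
    have "conn (insert q F) (insert q K) = conn F K + 2"
      using FK qF qK unfolding local_conn_def by simp
    then have FK0: "conn F K = 0"
      using conn_q_le[OF F K] local_conn_nonneg[of F K] by linarith
    \<comment> \<open>As r(K + q) = r(K) + 1 and \<open>conn F K = 0\<close>, this amounts to
      \<open>conn F D\<close> \<ge> 1. The mirror inequality gives \<open>conn C K\<close> \<ge>
      1.\<close>
    have D: "int (rank M (F \<union> D)) + int (rank M (insert q K)) \<le> int (rank M (F \<union> K)) + int (rank M D)"
    proof -
      have "insert q (F \<union> K) \<union> insert q D = insert q (F \<union> D)"
        "insert q K \<subseteq> insert q (F \<union> K) \<inter> insert q D" using K by auto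
      then show ?thesis
        using rank_submodular'[of "insert q K" "insert q (F \<union> K)" "insert q D"] FK q_D[of D]
          q_D[of "F \<union> D"] by simp
    qed
    have C: "int (rank M (C \<union> K)) + int (rank M (insert q F)) \<le> int (rank M (F \<union> K)) + int (rank M C)"
    proof -
      have "insert q (F \<union> K) \<union> insert q C = insert q (C \<union> K)"
        "insert q F \<subseteq> insert q (F \<union> K) \<inter> insert q C" using F by auto
      then show ?thesis
        using rank_submodular'[of "insert q F" "insert q (F \<union> K)" "insert q C"] FK q_C[of C]
          q_C[of "C \<union> K"] by simp
    qed
    have "conn F D \<le> 2" "conn C K \<le> 2"
      using local_conn_mono[OF F order_refl, of D] local_conn_mono[OF order_refl K, of C] conn_CD by auto
    \<comment> \<open>With connectivity 2 to D, F would act like C on Z, giving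
      \<open>conn F Z = 1\<close>.\<close>
    moreover have "conn F D \<noteq> 2"
      using local_conn_marginal[OF F Z_sub] conn_CD conn_CZ \<open>conn F Z \<noteq> 1\<close>
        local_conn_mono[OF F order_refl, of Z] by auto
    moreover have "conn C K \<noteq> 2"
      using conn_marginal_right[OF Y_sub K] conn_CD conn_YD \<open>conn Y K \<noteq> 1\<close>
        local_conn_mono[OF order_refl K, of Y] by auto
    ultimately have "conn F D = 1 \<and> conn C K = 1 \<and> conn F K = 0"
      using C D qF qK FK0 unfolding local_conn_def by linarith }
  then show "conn F Z = 1 \<or> conn Y K = 1 \<or> (conn F D = 1 \<and> conn C K = 1 \<and> conn F K = 0)" by blast
next
  have "rank M (insert q (F \<union> K)) = rank M (F \<union> K)"
    if "conn F D = 1" "conn C K = 1" "conn F K = 0"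
  proof -
    have "insert q (F \<union> D) \<union> insert q (C \<union> K) = insert q (C \<union> D)"
      "insert q (F \<union> K) \<subseteq> insert q (F \<union> D) \<inter> insert q (C \<union> K)" using F K by auto
    \<comment> \<open>The right side exceeds r(C \<union> D) by exactly r(F) + r(K) = r(F \<union>
      K): the two connectivities 1 are made up for by \<open>conn C D = 2\<close>.\<close>
    then have "rank M (C \<union> D) + rank M (insert q (F \<union> K)) \<le> rank M (F \<union> D) + rank M (C \<union> K)"
      using rank_submodular'[of "insert q (F \<union> K)" "insert q (F \<union> D)" "insert q (C \<union> K)"]
        q_C[of "C \<union> D"] q_C[of "C \<union> K"] q_D[of "F \<union> D"] by simp
    then show ?thesis
      using that conn_CD rank_mono[OF subset_insertI, of "F \<union> K" q] unfolding local_conn_def by linarith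
  qed
  then show "rank M (insert q (F \<union> K)) = rank M (F \<union> K)"
    if "conn F Z = 1 \<or> conn Y K = 1 \<or> (conn F D = 1 \<and> conn C K = 1 \<and> conn F K = 0)"
    using that span_left_iff[OF F] span_right_iff[OF K]
      rank_insert_eq_mono[OF _ Un_upper1, of q F K] rank_insert_eq_mono[OF _ Un_upper2, of q K F] by metis
qed

text \<open>Three cases by what F contributes to the guts. If F spans q, take F. If F meets the guts
  in nothing, only q is seen from D, and Y shows the same point. If F meets them in one point other
  than q, then F + q has connectivity 2 to D and looks like all of C.\<close>

lemma replace_point:
  assumes F: "F \<subseteq> C"
  shows "\<exists>W \<subseteq> C. \<forall>K \<subseteq> D. conn (insert q F) K = conn W K"
proof (cases "rank M (insert q F) = rank M F")
  case True
  then show ?thesis using F local_conn_insert_left by blast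
next
  case False
  then have qF: "rank M (insert q F) = rank M F + 1" using rank_insert_cases by blast
  have FD: "conn (insert q F) D = conn F D + 1"
    using qF q_D[of "F \<union> D"] unfolding local_conn_def by simp
  have le: "conn (insert q F) D \<le> 2"
    using local_conn_mono[of "insert q F" "insert q C" D D] F local_conn_insert_left[OF q_C[OF order_refl]]
      conn_CD by auto
  consider "conn F D = 0" | "conn F D = 1" using FD le local_conn_nonneg[of F D] by linarith
  then show ?thesis
  proof cases
    case 1
    have "conn (insert q F) K = conn Y K" if K: "K \<subseteq> D" for K
    proof -
      have "conn F (insert q K) \<le> conn F (insert q D)" using K by (intro local_conn_mono) auto
      also have "\<dots> = 0" using 1 q_D by (simp add: conn_insert_right)
      finally have *: "conn F (insert q K) = 0" using local_conn_nonneg by (metis order_antisym)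
      have "conn F K = 0" using * local_conn_mono[of F F K "insert q K"] local_conn_nonneg[of F K] by auto
      moreover have "conn Y K \<le> 1" "0 \<le> conn Y K"
        using local_conn_mono[OF order_refl K, of Y] conn_YD local_conn_nonneg by auto
      ultimately show ?thesis
        using * qF rank_insert_cases[of q K] span_right_iff[OF K] unfolding local_conn_def by auto
    qed
    then show ?thesis using Y_sub by blast
  next
    case 2
    have "conn (insert q F) K = conn C K" if K: "K \<subseteq> D" for K
    proof -
      have sub: "insert q F \<subseteq> insert q C" using F by auto
      have "conn (insert q C) V = conn C V" for V using local_conn_insert_left q_C by auto
      then show ?thesis
        using local_conn_marginal[OF sub K] local_conn_mono[OF sub order_refl, of K] FD 2 conn_CD by simp
    qed
    then show ?thesis by blast
  qed
qed

end

section \<open>The modular cut of a coherent separation\<close>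

locale coherent_guts = guts +
  assumes ground: "C \<union> D = ground M" "C \<inter> D = {}" and coherent: "coherent M C D Y Z"

lemma coherent_guts_swap: "coherent_guts M C D Y Z \<Longrightarrow> coherent_guts M D C Z Y"
  unfolding coherent_guts_def coherent_guts_axioms_def
  using guts_swap[of M C D Y Z] coherent_swap[of M C D Y Z]
  by (simp add: Un_commute[of D C] Int_commute[of D C])

text \<open>\<open>joins F K\<close>: the new point of the guts lies in the span of \<open>F \<union> K\<close>.\<close>

context guts
begin

definition joins :: "'a set \<Rightarrow> 'a set \<Rightarrow> bool" where
  "joins F K \<longleftrightarrow> conn F Z = 1 \<or> conn Y K = 1 \<or> (conn F D = 1 \<and> conn C K = 1 \<and> conn F K = 0)"

text \<open>Monotonicity and supermodularity against the whole sides. Later proofs pick facts by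
  position: 5 and 6 say that a set missing the prescribed point cannot contain the whole line, 11
  and 12 that a set containing the line acts as its entire side.\<close>

lemma conn_bounds:
  assumes "F \<subseteq> C" "K \<subseteq> D"
  shows "conn F Z \<le> 1" "conn Y K \<le> 1" "conn F D \<le> 2" "conn C K \<le> 2"
    "conn F Z \<noteq> 1 \<Longrightarrow> conn F D \<le> 1" "conn Y K \<noteq> 1 \<Longrightarrow> conn C K \<le> 1"
    "conn F Z \<le> conn F D" "conn Y K \<le> conn C K" "conn F K \<le> conn F D" "conn F K \<le> conn C K"
    "conn F D = 2 \<Longrightarrow> conn F K = conn C K" "conn C K = 2 \<Longrightarrow> conn F K = conn F D"
proof -
  show 1: "conn F Z \<le> 1" "conn Y K \<le> 1" "conn F D \<le> 2" "conn C K \<le> 2"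
    using local_conn_mono[OF assms(1) order_refl] local_conn_mono[OF order_refl assms(2)]
      conn_CD conn_CZ conn_YD by metis+
  show "conn F D \<le> 1" if "conn F Z \<noteq> 1"
    using local_conn_marginal[OF assms(1) Z_sub] conn_CD conn_CZ 1 that by auto
  show "conn C K \<le> 1" if "conn Y K \<noteq> 1"
    using conn_marginal_right[OF Y_sub assms(2)] conn_CD conn_YD 1 that by auto
  show "conn F Z \<le> conn F D" "conn Y K \<le> conn C K" "conn F K \<le> conn F D" and le: "conn F K \<le> conn C K"
    using assms Y_sub Z_sub by (intro local_conn_mono; auto)+
  show "conn F K = conn C K" if "conn F D = 2"
    using local_conn_marginal[OF assms] conn_CD that le by auto
  show "conn F K = conn F D" if "conn C K = 2"
    using conn_marginal_right[OF assms] conn_CD that \<open>conn F K \<le> conn F D\<close> by auto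
qed

text \<open>Only the condition \<open>conn F K = 0\<close> is not monotone in F. If F + x still
  misses the point of Z, its connectivity to D stays 1, and by supermodularity its connectivity to K
  cannot rise either.\<close>

lemma joins_insert:
  assumes F: "F \<subseteq> C" and K: "K \<subseteq> D" and x: "x \<in> C" and J: "joins F K"
  shows "joins (insert x F) K"
proof -
  have sub: "insert x F \<subseteq> C" "F \<subseteq> insert x F" using F x by auto
  have b: "conn (insert x F) Z \<le> 1" "conn (insert x F) Z \<noteq> 1 \<Longrightarrow> conn (insert x F) D \<le> 1"
    using conn_bounds[OF sub(1) K] by blast+
  have le: "conn F V \<le> conn (insert x F) V" for V by (rule local_conn_mono[OF sub(2) order_refl])
  consider "conn F Z = 1" | "conn Y K = 1" | "conn F D = 1" "conn C K = 1" "conn F K = 0"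
    using J unfolding joins_def by blast
  then show ?thesis
  proof cases
    case 1
    then have "conn (insert x F) Z = 1" using le[of Z] b(1) by linarith
    then show ?thesis unfolding joins_def by blast
  next
    case 2
    then show ?thesis unfolding joins_def by blast
  next
    case 3
    show ?thesis
    proof (cases "conn (insert x F) Z = 1")
      case True
      then show ?thesis unfolding joins_def by blast
    next
      case False
      then have "conn (insert x F) D = 1" using b(2) le[of D] 3 by linarith
      moreover have "conn (insert x F) K = 0"
        using local_conn_marginal[OF sub(2) K] le[of K] 3 calculation by linarith
      ultimately show ?thesis using 3 unfolding joins_def by blast
    qed
  qed
qed

end

context coherent_guts
begin

text \<open>Suppose x is spanned by F \<union> K but not by F, and the conclusion fails. Then x
  raises the connectivity of F to K from 0 to 1 and to D from 0 to 1. So F + x and K are parallel,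
  the joining must come from Z, and coherence transfers it to \<open>conn Y K = 1\<close>, a
  contradiction.\<close>

lemma joins_closure:
  assumes F: "F \<subseteq> C" and K: "K \<subseteq> D" and x: "x \<in> C"
    and r: "rank M (insert x F \<union> K) = rank M (F \<union> K)" and J: "joins (insert x F) K"
  shows "joins F K"
proof (cases "rank M (insert x F) = rank M F")
  case True
  then show ?thesis using J local_conn_insert_left[OF True] unfolding joins_def by simp
next
  case False
  then have rx: "rank M (insert x F) = rank M F + 1" using rank_insert_cases by blast
  have xF: "insert x F \<subseteq> C" "F \<subseteq> insert x F" using F x by auto
  have xK: "conn (insert x F) K = conn F K + 1" using r rx unfolding local_conn_def by simp
  have D: "conn F D + 1 \<le> conn (insert x F) D" using local_conn_marginal[OF xF(2) K] xK by linarith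
  have D': "conn (insert x F) D \<le> conn F D + 1" by (rule conn_insert_le)
  show ?thesis
  proof (rule ccontr)
    assume n: "\<not> joins F K"
    have n': "conn F Z \<noteq> 1" "conn Y K \<noteq> 1" using n unfolding joins_def by blast+
    have "conn C K \<le> 1" using conn_bounds(6)[OF F K n'(2)] .
    moreover have "conn (insert x F) K \<le> conn C K" using conn_bounds(10)[OF xF(1) K] .
    ultimately have "conn C K = 1" "conn F K = 0" "conn (insert x F) K = 1"
      using xK local_conn_nonneg[of F K] by linarith+
    moreover have "conn F D \<noteq> 1" using n calculation unfolding joins_def by auto
    then have "conn (insert x F) D = 1"
      using D D' conn_bounds(5)[OF F K n'(1)] local_conn_nonneg[of F D] by linarith
    ultimately show False
      using coherent xF K J n unfolding coherent_def joins_def by (metis zero_neq_one)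
  qed
qed

text \<open>Refuted by excessive connectivity. If F meets the guts in a point, then a and b each
  raise its connectivity to D to 2, hence together to 3. If F meets nothing, F + a + b fills the
  line; comparison with K gives \<open>conn C K = 0\<close>, so both augmentations join through Z,
  and F + a + b would have connectivity 2 to Z.\<close>

lemma joins_modular_same:
  assumes F: "F \<subseteq> C" and K: "K \<subseteq> D" and ab: "a \<in> C" "b \<in> C"
    and r: "rank M (insert a (insert b F) \<union> K) = rank M (F \<union> K) + 2"
    and J: "joins (insert a F) K" "joins (insert b F) K"
  shows "joins F K"
proof (rule ccontr)
  assume n: "\<not> joins F K"
  let ?ab = "insert a (insert b F)"
  have sub: "insert a F \<subseteq> C" "insert b F \<subseteq> C" "?ab \<subseteq> C" using F ab by auto
  note b = conn_bounds[OF F K]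
  have le: "conn U V \<le> conn (insert x U) V" for x U V by (rule local_conn_mono) auto
  have rab: "rank M ?ab = rank M F + 2"
    using r rank_submodular'[of F ?ab "F \<union> K"] rank_insert_le[of a "insert b F"] rank_insert_le[of b F]
    by (auto simp: Un_assoc[symmetric] Un_absorb2 subset_insertI2)
  have ra: "rank M (insert a F) = rank M F + 1" "rank M (insert b F) = rank M F + 1"
    using rab rank_insert_le[of a "insert b F"] rank_insert_le[of b F]
      rank_insert_le[of b "insert a F"] rank_insert_le[of a F] by (auto simp: insert_commute)
  have FK: "conn ?ab K = conn F K" using r rab unfolding local_conn_def by simp
  \<comment> \<open>Each of a and b lies in the span of F \<union> V, while together they raise r(F)
    by 2.\<close>
  have step: "conn ?ab V = conn F V + 2" if "conn (insert a F) V = conn F V + 1" "conn (insert b F) V = conn F V + 1" for V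
  proof -
    have "rank M (insert a (F \<union> V)) = rank M (F \<union> V)" "rank M (insert b (F \<union> V)) = rank M (F \<union> V)"
      using that ra unfolding local_conn_def by simp_all
    then have "rank M (insert a (insert b (F \<union> V))) = rank M (F \<union> V)"
      using rank_insert_eq_mono[of a "F \<union> V" "insert b (F \<union> V)"] by auto
    then show ?thesis using rab unfolding local_conn_def by simp
  qed
  have up: "conn (insert x F) V \<le> conn F V + 1" for x V by (rule conn_insert_le)
  have mg: "conn (insert x F) Z - conn F Z \<le> conn (insert x F) D - conn F D" for x
    using Z_sub by (intro local_conn_marginal) auto
  have Z0: "conn F Z = 0" and Y0: "conn Y K \<noteq> 1" and FD: "conn F D \<le> 1"
    using n b local_conn_nonneg[of F Z] unfolding joins_def by linarith+
  consider "conn F D = 1" | "conn F D = 0" using FD local_conn_nonneg[of F D] by linarith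
  then show False
  proof cases
    case 1
    have "conn (insert x F) D = 2" if "joins (insert x F) K" "x \<in> C" for x
    proof -
      have "conn (insert x F) Z = 1"
      proof (rule ccontr)
        assume "conn (insert x F) Z \<noteq> 1"
        then have "conn C K = 1" "conn (insert x F) K = 0" using that Y0 unfolding joins_def by auto
        then show False using n 1 le[of F K x] local_conn_nonneg[of F K] unfolding joins_def by auto
      qed
      then show ?thesis using mg[of x] up[of x D] 1 Z0 by linarith
    qed
    then have "conn ?ab D = 3" using step[of D] J ab 1 by auto
    then show False using conn_bounds[OF sub(3) K] by linarith
  next
    case 2
    have D1: "conn (insert x F) D = 1" if "joins (insert x F) K" for x
      using that mg[of x] up[of x D] 2 Z0 Y0 unfolding joins_def by linarith
    have "conn ?ab D = 2" using step[of D] D1 J 2 by auto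
    then have "conn ?ab K = conn C K" using conn_bounds[OF sub(3) K] by blast
    then have "conn C K = 0" using FK 2 b local_conn_nonneg[of F K] by linarith
    then have "conn (insert a F) Z = 1" "conn (insert b F) Z = 1" using J Y0 unfolding joins_def by auto
    then have "conn ?ab Z = 2" using step[of Z] Z0 by auto
    then show False using conn_bounds[OF sub(3) K] by linarith
  qed
qed

text \<open>The rank jump by 2 keeps \<open>conn F K\<close> unchanged when a and b are added on
  their sides, whereas the two joinings force it to grow.\<close>

lemma joins_modular_opposite:
  assumes F: "F \<subseteq> C" and K: "K \<subseteq> D" and ab: "a \<in> C" "b \<in> D"
    and r: "rank M (insert a F \<union> insert b K) = rank M (F \<union> K) + 2"
    and J: "joins (insert a F) K" "joins F (insert b K)"
  shows "joins F K"
proof (rule ccontr)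
  assume n: "\<not> joins F K"
  have sub: "insert a F \<subseteq> C" "insert b K \<subseteq> D" using F K ab by auto
  note b = conn_bounds[OF F K] and bb = conn_bounds[OF sub]
  have FK: "conn (insert a F) (insert b K) = conn F K"
  proof -
    have "rank M (insert a F \<union> insert b K) + rank M F \<le> rank M (insert a F) + rank M (F \<union> insert b K)"
      using rank_submodular'[of F "insert a F" "F \<union> insert b K"] by (auto simp: Un_absorb2 insert_commute)
    moreover have "rank M (F \<union> insert b K) \<le> rank M (F \<union> K) + 1"
      using rank_insert_le[of b "F \<union> K"] by simp
    ultimately have 1: "rank M (insert a F) = rank M F + 1" using r rank_insert_le[of a F] by linarith
    have "rank M (insert a F \<union> insert b K) + rank M K \<le> rank M (insert b K) + rank M (insert a F \<union> K)"
      using rank_submodular'[of K "insert b K" "insert a F \<union> K"]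
      by (auto simp: Un_absorb1 insert_commute Un_left_commute Un_commute)
    moreover have "rank M (insert a F \<union> K) \<le> rank M (F \<union> K) + 1"
      using rank_insert_le[of a "F \<union> K"] by simp
    ultimately have 2: "rank M (insert b K) = rank M K + 1" using r rank_insert_le[of b K] by linarith
    show "conn (insert a F) (insert b K) = conn F K" using 1 2 r unfolding local_conn_def by linarith
  qed
  have Z0: "conn F Z = 0" and Y0: "conn Y K = 0" and FD: "conn F D \<le> 1" and CK: "conn C K \<le> 1"
    using n b local_conn_nonneg[of F Z] local_conn_nonneg[of Y K] unfolding joins_def by linarith+
  have mZ: "conn (insert a F) Z - conn F Z \<le> conn (insert a F) D - conn F D"
    using Z_sub by (intro local_conn_marginal) auto
  have mY: "conn Y (insert b K) - conn Y K \<le> conn C (insert b K) - conn C K"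
    using Y_sub by (intro conn_marginal_right) auto
  have le: "conn F K \<le> conn (insert a F) K" "conn F K \<le> conn F (insert b K)"
    by (rule local_conn_mono; auto)+
  have nn: "0 \<le> conn F D" "0 \<le> conn C K" "0 \<le> conn F K" by (rule local_conn_nonneg)+
  have J1: "conn (insert a F) Z = 1 \<or> conn (insert a F) D = 1 \<and> conn C K = 1 \<and> conn (insert a F) K = 0"
    using J(1) Y0 unfolding joins_def by auto
  have J2: "conn Y (insert b K) = 1 \<or> conn F D = 1 \<and> conn C (insert b K) = 1 \<and> conn F (insert b K) = 0"
    using J(2) Z0 unfolding joins_def by auto
  have n': "\<not> (conn F D = 1 \<and> conn C K = 1 \<and> conn F K = 0)" using n unfolding joins_def by auto
  show False
  \<comment> \<open>If neither part meets the guts, F + a and K + b both acquire the prescribed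
    point, and coherence makes them parallel. Otherwise one part is raised to connectivity 2, acts
    as its whole side, and sees too much of the other.\<close>
  proof (cases "conn F D = 0 \<and> conn C K = 0")
    case True
    then have "conn (insert a F) Z = 1" "conn Y (insert b K) = 1" using J1 J2 by auto
    moreover have "conn (insert a F) D = 1" "conn C (insert b K) = 1"
    proof -
      have "conn (insert a F) D \<le> 1"
        using True conn_insert_le[of a F D] by linarith
      then show "conn (insert a F) D = 1" using bb(7) calculation(1) by linarith
      have "conn C (insert b K) \<le> 1"
        using True conn_insert_le[of b K C] by (simp add: local_conn_commute)
      then show "conn C (insert b K) = 1" using bb(8) calculation(2) by linarith
    qed
    ultimately have "conn (insert a F) (insert b K) = 1"
      using coherent sub unfolding coherent_def by blast
    then show False using FK True b(9) by linarith
  next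
    case False
    have "conn F D = 0 \<or> conn F D = 1" "conn C K = 0 \<or> conn C K = 1" "conn F K = 0 \<or> conn F K = 1"
      using FD CK nn b(9) by linarith+
    then consider "conn F D = 1" "conn C K = 1" "conn F K = 1" | "conn F D = 1" "conn C K = 0"
      | "conn F D = 0" "conn C K = 1"
      using False n' by blast
    then show False
    proof cases
      case 1
      then have "conn (insert a F) D = 2" "conn C (insert b K) = 2"
        using J1 J2 le mZ mY Z0 Y0 bb(3,4) by linarith+
      then show False using bb(11) FK 1 by auto
    next
      case 2
      then have "conn (insert a F) D = 2" "1 \<le> conn C (insert b K)"
        using J1 J2 le mZ mY Z0 Y0 bb(3,4) by linarith+
      then show False using bb(11) FK 2 b(10) by auto
    next
      case 3
      then have "conn C (insert b K) = 2" "1 \<le> conn (insert a F) D"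
        using J1 J2 le mZ mY Z0 Y0 bb(3,4) by linarith+
      then show False using bb(12) FK 3 b(9) by auto
    qed
  qed
qed

end

context guts
begin

lemma joins_commute: "guts.joins M D C Z Y K F = joins F K"
  unfolding joins_def guts.joins_def[OF guts_swap[OF guts_axioms]]
  by (auto simp: local_conn_commute)

end

context coherent_guts
begin

lemma modular_cut_joins: "modular_cut M (\<lambda>G. joins (G \<inter> C) (G \<inter> D))"
proof
  interpret swap: coherent_guts M D C Z Y by (rule coherent_guts_swap) unfold_locales
  note commute = joins_commute
  have ins: "insert x U \<inter> C = insert x (U \<inter> C) \<and> insert x U \<inter> D = U \<inter> D" if "x \<in> C" for x U
    using that ground(2) by auto
  have ins': "insert x U \<inter> D = insert x (U \<inter> D) \<and> insert x U \<inter> C = U \<inter> C" if "x \<in> D" for x U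
    using that ground(2) by auto
  have un: "(U \<inter> C) \<union> (U \<inter> D) = U" "(U \<inter> D) \<union> (U \<inter> C) = U" if "U \<subseteq> ground M" for U
    using that ground(1) by auto
  fix U assume U: "U \<subseteq> ground M"
  { fix x assume x: "x \<in> ground M" and J: "joins (U \<inter> C) (U \<inter> D)"
    show "joins (insert x U \<inter> C) (insert x U \<inter> D)"
    proof (cases "x \<in> C")
      case True
      then show ?thesis using joins_insert[OF Int_lower2 Int_lower2 True J] ins by simp
    next
      case False
      then have "x \<in> D" using x ground by auto
      then show ?thesis using swap.joins_insert[of "U \<inter> D" "U \<inter> C" x] J ins' commute by simp
    qed }
  { fix x assume x: "x \<in> ground M" and r: "rank M (insert x U) = rank M U"
      and J: "joins (insert x U \<inter> C) (insert x U \<inter> D)"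
    show "joins (U \<inter> C) (U \<inter> D)"
    proof (cases "x \<in> C")
      case True
      have "insert x (U \<inter> C) \<union> (U \<inter> D) = insert x U" using U ground(1) by auto
      then have "rank M (insert x (U \<inter> C) \<union> (U \<inter> D)) = rank M ((U \<inter> C) \<union> (U \<inter> D))"
        using r un[OF U] by simp
      then show ?thesis
        using joins_closure[OF Int_lower2 Int_lower2 True] J ins[OF True, of U] by simp
    next
      case False
      then have xD: "x \<in> D" using x ground by auto
      have "insert x (U \<inter> D) \<union> (U \<inter> C) = insert x U" using U ground(1) by auto
      then have "rank M (insert x (U \<inter> D) \<union> (U \<inter> C)) = rank M ((U \<inter> D) \<union> (U \<inter> C))"
        using r un[OF U] by simp
      then show ?thesis
        using swap.joins_closure[OF Int_lower2 Int_lower2 xD] J ins'[OF xD, of U] commute by simp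
    qed }
  { fix a b assume a: "a \<in> ground M" and b: "b \<in> ground M"
      and r: "rank M (insert a (insert b U)) = rank M U + 2"
      and J: "joins (insert a U \<inter> C) (insert a U \<inter> D)" "joins (insert b U \<inter> C) (insert b U \<inter> D)"
    consider "a \<in> C" "b \<in> C" | "a \<in> D" "b \<in> D" | "a \<in> C" "b \<in> D" | "a \<in> D" "b \<in> C"
      using a b ground by auto
    then show "joins (U \<inter> C) (U \<inter> D)"
    proof cases
      case 1
      have "insert a (insert b (U \<inter> C)) \<union> (U \<inter> D) = insert a (insert b U)" using U ground(1) by auto
      then have "rank M (insert a (insert b (U \<inter> C)) \<union> (U \<inter> D)) = rank M ((U \<inter> C) \<union> (U \<inter> D)) + 2"
        using r un[OF U] by simp
      then show ?thesis
        using joins_modular_same[OF Int_lower2 Int_lower2 1] J ins[OF 1(1), of U] ins[OF 1(2), of U] by simp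
    next
      case 2
      have "insert a (insert b (U \<inter> D)) \<union> (U \<inter> C) = insert a (insert b U)" using U ground(1) by auto
      then have "rank M (insert a (insert b (U \<inter> D)) \<union> (U \<inter> C)) = rank M ((U \<inter> D) \<union> (U \<inter> C)) + 2"
        using r un[OF U] by simp
      then show ?thesis
        using swap.joins_modular_same[OF Int_lower2 Int_lower2 2] J ins'[OF 2(1), of U]
          ins'[OF 2(2), of U] commute by simp
    next
      case 3
      have "insert a (U \<inter> C) \<union> insert b (U \<inter> D) = insert a (insert b U)" using U ground(1) by auto
      then have "rank M (insert a (U \<inter> C) \<union> insert b (U \<inter> D)) = rank M ((U \<inter> C) \<union> (U \<inter> D)) + 2"
        using r un[OF U] by simp
      then show ?thesis
        using joins_modular_opposite[OF Int_lower2 Int_lower2 3] J ins[OF 3(1), of U] ins'[OF 3(2), of U]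
        by simp
    next
      case 4
      have "insert a (U \<inter> D) \<union> insert b (U \<inter> C) = insert a (insert b U)" using U ground(1) by auto
      then have "rank M (insert a (U \<inter> D) \<union> insert b (U \<inter> C)) = rank M ((U \<inter> D) \<union> (U \<inter> C)) + 2"
        using r un[OF U] by simp
      then show ?thesis
        using swap.joins_modular_opposite[OF Int_lower2 Int_lower2 4] J ins'[OF 4(1), of U]
          ins[OF 4(2), of U] commute by simp
    qed }
qed

end

section \<open>Extensions, strands and circuits\<close>

lemma indeps_extension: "extension M P N \<Longrightarrow> indeps M = {I \<in> indeps N. I \<inter> P = {}}"
  unfolding extension_def delete_def by auto

lemma indeps_extension_iff:
  assumes "extension M P N" "I \<subseteq> ground M"
  shows "I \<in> indeps N \<longleftrightarrow> I \<in> indeps M"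
  using assms indeps_extension[OF assms(1)] unfolding extension_def by auto

lemma rank_extension:
  assumes "extension M P N" "U \<subseteq> ground M"
  shows "rank N U = rank M U"
proof -
  have "{I \<in> indeps N. I \<subseteq> U} = {I \<in> indeps M. I \<subseteq> U}"
    using indeps_extension_iff[OF assms(1)] assms(2) by blast
  then show ?thesis unfolding rank_def by simp
qed

lemma local_conn_extension:
  assumes "extension M P N" "U \<subseteq> ground M" "V \<subseteq> ground M"
  shows "local_conn N U V = local_conn M U V"
  using assms rank_extension[OF assms(1)] unfolding local_conn_def by simp

lemma circuit_extension:
  assumes "extension M P N" "C \<subseteq> ground M"
  shows "circuit N C \<longleftrightarrow> circuit M C"
proof -
  have "ground M \<subseteq> ground N" using assms(1) unfolding extension_def by auto
  moreover have "D \<in> indeps N \<longleftrightarrow> D \<in> indeps M" if "D \<subseteq> C" for D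
    using indeps_extension_iff[OF assms(1)] assms(2) that by blast
  ultimately show ?thesis using assms(2) unfolding circuit_def by blast
qed

lemma extension_trans:
  assumes "extension M P N" "extension N P' N'"
  shows "extension M (P \<union> P') N'"
proof -
  have "indeps M = {I \<in> indeps N'. I \<inter> (P \<union> P') = {}}"
    using indeps_extension[OF assms(1)] indeps_extension[OF assms(2)] by auto
  moreover have "ground M \<inter> (P \<union> P') = {}" "ground N' = ground M \<union> (P \<union> P')"
    using assms unfolding extension_def by auto
  ultimately show ?thesis
    using assms unfolding extension_def delete_def by (auto intro!: matroid.equality)
qed

lemma matroid_delete: "matroid N \<Longrightarrow> matroid (delete N P)"
proof -
  assume "matroid N"
  then interpret matroid N .
  show ?thesis
  proof
    show "\<exists>x \<in> J - I. insert x I \<in> indeps (delete N P)"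
      if "I \<in> indeps (delete N P)" "J \<in> indeps (delete N P)" "card I < card J" for I J
      using that augment[of I J] by (auto simp: delete_def)
  qed (use finite_ground indeps_subset empty_indep indep_mono in \<open>auto simp: delete_def\<close>)
qed

text \<open>The intermediate matroid is forced to be a deletion; this is how uniqueness for single
  points yields uniqueness for sets of points.\<close>

lemma extension_split:
  assumes "extension M (P \<union> P') N" "P \<inter> P' = {}"
  shows "extension M P (delete N P')" "extension (delete N P') P' N"
proof -
  have N: "matroid N" "ground N = ground M \<union> (P \<union> P')" "ground M \<inter> (P \<union> P') = {}"
    and M: "delete N (P \<union> P') = M"
    using assms(1) unfolding extension_def by auto
  have "delete (delete N P') P = delete N (P \<union> P')"
    unfolding delete_def by auto
  then show "extension M P (delete N P')"
    using N M assms(2) matroid_delete[OF N(1)] unfolding extension_def by (auto simp: delete_def)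
  show "extension (delete N P') P' N"
    using N assms(2) unfolding extension_def by (auto simp: delete_def)
qed

lemma extension_empty: "matroid M \<Longrightarrow> extension M {} N \<longleftrightarrow> N = M"
  unfolding extension_def delete_def by auto

context matroid
begin

text \<open>A dependent strand has an element spanned by the others; dropping it keeps the
  connectivity, against minimality.\<close>

lemma strand_indep:
  assumes "strand M A B S"
  shows "S \<in> indeps M"
proof (rule ccontr)
  assume S: "S \<notin> indeps M"
  obtain I where I: "I \<in> indeps M" "I \<subseteq> S" "card I = rank M S" using rank_witness by blast
  moreover have "I \<noteq> S" using I(1) S by blast
  ultimately obtain y where y: "y \<in> S" "y \<notin> I" by blast
  have "rank M S \<le> rank M (S - {y})" using card_le_rank[OF I(1), of "S - {y}"] I y by auto
  then have "rank M (insert y (S - {y})) = rank M (S - {y})"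
    using rank_mono[of "S - {y}" S] y by (simp add: insert_absorb)
  then have "conn S B = conn (S - {y}) B"
    using local_conn_insert_left[of y "S - {y}" B] y by (simp add: insert_absorb)
  moreover have "S - {y} \<subset> S" using y by auto
  ultimately show False using assms unfolding strand_def by metis
qed

lemma strand_proper:
  assumes "strand M A B S" "S' \<subset> S"
  shows "conn S' B = 0"
proof -
  have "conn S B = 1" "conn S' B \<noteq> 1" "S' \<subseteq> S" using assms unfolding strand_def by blast+
  then show ?thesis using local_conn_mono_left[of S' S B] local_conn_nonneg[of S' B] by linarith
qed

lemma circuit_insert_iff:
  assumes "Y \<in> indeps M" "Y \<noteq> {}" "q \<notin> Y" "q \<in> ground M"
  shows "circuit M (Y \<union> {q}) \<longleftrightarrow> insert q Y \<notin> indeps M \<and> (\<forall>S. S \<subset> Y \<longrightarrow> insert q S \<in> indeps M)"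
    (is "?L \<longleftrightarrow> ?R")
proof
  show ?R if ?L
  proof -
    have "insert q S \<subset> Y \<union> {q}" if "S \<subset> Y" for S using that assms(3) by auto
    then show ?thesis using that unfolding circuit_def by simp
  qed
  show ?L if R: ?R
    unfolding circuit_def
  proof (intro conjI allI impI)
    show "Y \<union> {q} \<subseteq> ground M" using assms indeps_subset by auto
    show "Y \<union> {q} \<notin> indeps M" using R by simp
    fix S assume S: "S \<subset> Y \<union> {q}"
    show "S \<in> indeps M"
    proof (cases "q \<in> S")
      case True
      then have "S - {q} \<subset> Y" using S by auto
      then have "insert q (S - {q}) \<in> indeps M" using R by blast
      then show ?thesis using True by (simp add: insert_absorb)
    next
      case False
      then show ?thesis using S assms(1) indep_mono by blast
    qed
  qed
qed

lemma circuit_insert_rank: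
  assumes "circuit M (Y \<union> {q})" "Y \<noteq> {}" "q \<notin> Y"
  shows "rank M (insert q Y) = rank M Y" "rank M {q} = 1"
proof -
  have c: "insert q Y \<notin> indeps M" "\<And>S. S \<subset> insert q Y \<Longrightarrow> S \<in> indeps M"
    using assms(1) unfolding circuit_def by auto
  have Y: "Y \<in> indeps M" "{q} \<in> indeps M" using c(2) assms by auto
  have "finite Y" using finite_indep Y by auto
  then have "rank M (insert q Y) \<noteq> rank M Y + 1"
    using indep_if_rank[of "insert q Y"] c(1) rank_indep[OF Y(1)] assms(3) by auto
  then show "rank M (insert q Y) = rank M Y" using rank_insert_cases by blast
  show "rank M {q} = 1" using rank_indep[OF Y(2)] by simp
qed

lemma insert_indep_iff:
  assumes "I \<in> indeps M" "q \<notin> I"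
  shows "insert q I \<in> indeps M \<longleftrightarrow> rank M (insert q I) \<noteq> rank M I"
proof -
  have "finite I" using finite_indep assms by auto
  then show ?thesis
    using rank_indep[of "insert q I"] rank_indep[OF assms(1)] rank_insert_cases[of q I]
      indep_if_rank[of "insert q I"] assms(2) by auto
qed

end

text \<open>The invariant for a point still to be added. Coherence stands in for the existence of a
  one-point extension because it can be transported to larger matroids.\<close>

definition guts_system :: "'a matroid \<Rightarrow> 'a set \<Rightarrow> 'a set \<Rightarrow> 'a set \<Rightarrow> 'a set \<Rightarrow> bool" where
  "guts_system M A B Y Z \<longleftrightarrow> coherent_guts M A B Y Z \<and> strand M A B Y \<and> strand M B A Z"

definition guts_extension :: "'a matroid \<Rightarrow> 'a set \<Rightarrow> 'a set \<Rightarrow> 'a \<Rightarrow> 'a matroid \<Rightarrow> bool" where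
  "guts_extension M Y Z q N \<longleftrightarrow>
     extension M {q} N \<and> circuit N (Y \<union> {q}) \<and> circuit N (Z \<union> {q})"

lemma guts_system_swap: "guts_system M A B Y Z \<Longrightarrow> guts_system M B A Z Y"
  unfolding guts_system_def using coherent_guts_swap[of M A B Y Z] by simp

lemma guts_extension_swap: "guts_extension M Y Z q N \<Longrightarrow> guts_extension M Z Y q N"
  unfolding guts_extension_def by blast

lemma guts_extension:
  assumes "guts M A B Y Z" "A \<union> B \<subseteq> ground M" "extension M P N"
  shows "guts N A B Y Z"
proof -
  interpret guts M A B Y Z by fact
  have sub: "A \<subseteq> ground M" "B \<subseteq> ground M" "Y \<subseteq> ground M" "Z \<subseteq> ground M"
    using Y_sub Z_sub assms(2) by auto
  show ?thesis
    unfolding guts_def guts_axioms_def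
    using assms(3) sub Y_sub Z_sub conn_CD conn_YD conn_CZ conn_YZ local_conn_extension[OF assms(3)]
    unfolding extension_def by simp
qed

lemma guts_point_extension:
  assumes "guts M A B Y Z" "A \<union> B \<subseteq> ground M" "guts_extension M Y Z q N"
  shows "guts_point N A B Y Z q"
proof -
  interpret M: guts M A B Y Z by fact
  have ext: "extension M {q} N" using assms(3) unfolding guts_extension_def by blast
  interpret N: guts N A B Y Z using guts_extension[OF assms(1,2) ext] .
  have q: "q \<notin> Y" "q \<notin> Z" using ext M.Y_sub M.Z_sub assms(2) unfolding extension_def by auto
  have "Y \<noteq> {}" "Z \<noteq> {}" using M.conn_YZ M.conn_empty by force+
  then show ?thesis
    using N.circuit_insert_rank[of Y q] N.circuit_insert_rank[of Z q] q assms(3) N.guts_axioms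
    unfolding guts_extension_def guts_point_def guts_point_axioms_def by blast
qed

text \<open>Coherence holds in N because q is there, and it speaks only of subsets of A \<union> B,
  on which N and M agree.\<close>

lemma coherent_guts_if_extension:
  assumes "guts M A B Y Z" "A \<union> B = ground M" "A \<inter> B = {}" "guts_extension M Y Z q N"
  shows "coherent_guts M A B Y Z"
proof -
  interpret M: guts M A B Y Z by fact
  interpret N: guts_point N A B Y Z q using guts_point_extension[OF assms(1) _ assms(4)] assms(2) by simp
  have ext: "extension M {q} N" using assms(4) unfolding guts_extension_def by blast
  have eq: "local_conn N U V = local_conn M U V" if "U \<subseteq> A \<union> B" "V \<subseteq> A \<union> B" for U V
    using local_conn_extension[OF ext] that assms(2) by simp
  have "coherent M A B Y Z"
    unfolding coherent_def
  proof (intro allI impI)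
    fix F K assume FK: "F \<subseteq> A" "K \<subseteq> B" "local_conn M F B = 1" "local_conn M A K = 1"
    have "local_conn N F B = local_conn M F B" "local_conn N A K = local_conn M A K"
      "local_conn N F Z = local_conn M F Z" "local_conn N Y K = local_conn M Y K"
      "local_conn N F K = local_conn M F K"
      using FK(1,2) M.Y_sub M.Z_sub by (intro eq; auto)+
    then show "(local_conn M F Z = 1 \<longrightarrow> local_conn M Y K = 1 \<longrightarrow> local_conn M F K = 1) \<and>
        (local_conn M F K = 1 \<longrightarrow> (local_conn M F Z = 1 \<longleftrightarrow> local_conn M Y K = 1))"
      using N.coherent FK unfolding coherent_def by metis
  qed
  then show ?thesis
    using assms M.guts_axioms unfolding coherent_guts_def coherent_guts_axioms_def by blast
qed

text \<open>Existence: \<open>joins\<close> gives a modular cut, and minimality of the strands turns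
  Y + q and Z + q into circuits, since a proper subset of a strand has connectivity 0 to the other
  side and so joins nothing. Uniqueness: \<open>span_iff\<close> leaves no choice.\<close>

lemma ex1_guts_extension:
  assumes "guts_system M A B Y Z" "q \<notin> ground M"
  shows "\<exists>!N. guts_extension M Y Z q N"
proof -
  interpret coherent_guts M A B Y Z using assms(1) unfolding guts_system_def by blast
  have strands: "strand M A B Y" "strand M B A Z" using assms(1) unfolding guts_system_def by auto
  define Q where "Q = (\<lambda>G. joins (G \<inter> A) (G \<inter> B))"
  interpret cut: modular_cut M Q unfolding Q_def by (rule modular_cut_joins)
  let ?N = "cut_extension M Q q"
  interpret N: matroid ?N using cut.matroid_cut_extension[OF assms(2)] .
  have qI: "q \<notin> I" if "I \<in> indeps M" for I using that indeps_subset assms(2) by auto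
  have iff1: "insert q I \<in> indeps ?N \<longleftrightarrow> I \<in> indeps M \<and> \<not> Q I" if "q \<notin> I" for I
    using that qI by (auto simp: cut_extension_def image_iff dest: insert_ident[THEN iffD1, rotated 2])
  have ext: "extension M {q} ?N"
    using assms(2) N.matroid_axioms qI
    unfolding extension_def by (auto simp: cut_extension_def delete_def intro!: matroid.equality)
  have Y: "Y \<in> indeps M" and Z: "Z \<in> indeps M" using strands strand_indep by blast+
  have ne: "Y \<noteq> {}" "Z \<noteq> {}" using conn_YZ conn_empty by force+
  have subN: "indeps M \<subseteq> indeps ?N" "q \<in> ground ?N" by (auto simp: cut_extension_def)
  have int: "S \<inter> A = S \<and> S \<inter> B = {}" if "S \<subseteq> Y" for S using that Y_sub ground(2) by auto
  have int': "S \<inter> A = {} \<and> S \<inter> B = S" if "S \<subseteq> Z" for S using that Z_sub ground(2) by auto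
  have "circuit ?N (Y \<union> {q})"
  proof (subst N.circuit_insert_iff)
    have "\<not> Q S" if "S \<subset> Y" for S
    proof -
      have "conn S Z \<le> conn S B" using Z_sub by (intro local_conn_mono) auto
      then have "conn S Z \<noteq> 1" "conn S B = 0" using strand_proper[OF strands(1) that] by auto
      then show ?thesis using int[of S] that conn_empty unfolding Q_def joins_def by auto
    qed
    moreover have "Q Y" using int[of Y] conn_YZ unfolding Q_def joins_def by simp
    ultimately show "insert q Y \<notin> indeps ?N \<and> (\<forall>S. S \<subset> Y \<longrightarrow> insert q S \<in> indeps ?N)"
      using iff1 qI[OF Y] indep_mono[OF Y] by (metis psubset_imp_subset subsetD)
  qed (use Y subN ne qI in auto)
  moreover have "circuit ?N (Z \<union> {q})"
  proof (subst N.circuit_insert_iff)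
    have "\<not> Q S" if "S \<subset> Z" for S
    proof -
      have "conn S Y \<le> conn S A" using Y_sub by (intro local_conn_mono) auto
      then have "conn Y S \<noteq> 1" "conn A S = 0"
        using strand_proper[OF strands(2) that] by (auto simp: local_conn_commute)
      then show ?thesis using int'[of S] that conn_empty unfolding Q_def joins_def by auto
    qed
    moreover have "Q Z" using int'[of Z] conn_YZ unfolding Q_def joins_def by simp
    ultimately show "insert q Z \<notin> indeps ?N \<and> (\<forall>S. S \<subset> Z \<longrightarrow> insert q S \<in> indeps ?N)"
      using iff1 qI[OF Z] indep_mono[OF Z] by (metis psubset_imp_subset subsetD)
  qed (use Z subN ne qI in auto)
  ultimately have "guts_extension M Y Z q ?N" using ext unfolding guts_extension_def by blast
  moreover have "N = ?N" if N: "guts_extension M Y Z q N" for N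
  proof -
    have ext': "extension M {q} N" using N unfolding guts_extension_def by blast
    interpret P: guts_point N A B Y Z q
      using guts_point_extension[OF guts_axioms _ N] ground by simp
    have "I \<in> indeps N \<longleftrightarrow> I \<in> indeps ?N" for I
    proof (cases "q \<in> I")
      case False
      then show ?thesis using indeps_extension[OF ext'] indeps_extension[OF ext] by auto
    next
      case True
      define J where "J = I - {q}"
      have I: "I = insert q J" "q \<notin> J" using True unfolding J_def by auto
      have J: "J \<in> indeps M \<longleftrightarrow> J \<in> indeps N" using indeps_extension[OF ext'] I by auto
      have "insert q J \<in> indeps N \<longleftrightarrow> \<not> Q J" if "J \<in> indeps M"
      proof -
        have sub: "J \<subseteq> A \<union> B" using that indeps_subset ground by auto
        have eq: "local_conn N U V = local_conn M U V" if "U \<subseteq> A \<union> B" "V \<subseteq> A \<union> B" for U V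
          using local_conn_extension[OF ext'] that ground(1) by simp
        have "local_conn N (J \<inter> A) Z = conn (J \<inter> A) Z" "local_conn N Y (J \<inter> B) = conn Y (J \<inter> B)"
          "local_conn N (J \<inter> A) B = conn (J \<inter> A) B" "local_conn N A (J \<inter> B) = conn A (J \<inter> B)"
          "local_conn N (J \<inter> A) (J \<inter> B) = conn (J \<inter> A) (J \<inter> B)"
          using Y_sub Z_sub by (intro eq; auto)+
        moreover have "(J \<inter> A) \<union> (J \<inter> B) = J" using sub by auto
        \<comment> \<open>Every connectivity in \<open>span_iff\<close> involves old elements only
          and is the same in N as in M.\<close>
        ultimately have "rank N (insert q J) = rank N J \<longleftrightarrow> Q J"
          using P.span_iff[of "J \<inter> A" "J \<inter> B"] unfolding Q_def joins_def by simp
        then show ?thesis using P.insert_indep_iff[of J q] that J I by simp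
      qed
      moreover have "J \<in> indeps M" if "insert q J \<in> indeps N" using P.indep_mono[OF that] J by auto
      ultimately show ?thesis using iff1[OF I(2)] I by blast
    qed
    then have "indeps N = indeps ?N" by blast
    moreover have "ground N = ground ?N" using ext ext' unfolding extension_def by simp
    ultimately show ?thesis by (simp add: matroid.equality)
  qed
  ultimately show ?thesis by blast
qed

text \<open>q is in the span of A, hence of C, so adding it to C changes no connectivity with C.
  What is left is coherence for sets F containing q.\<close>

lemma guts_system_insert:
  assumes AB: "guts_system M A B Y Z" and N: "guts_extension M Y Z q N"
    and CD: "guts_system M C D S R" and AC: "A \<subseteq> C"
  shows "guts_system N (insert q C) D S R"
proof -
  interpret AB: coherent_guts M A B Y Z using AB unfolding guts_system_def by blast
  interpret CD: coherent_guts M C D S R using CD unfolding guts_system_def by blast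
  have ext: "extension M {q} N" using N unfolding guts_extension_def by blast
  interpret P: guts_point N A B Y Z q
    using guts_point_extension[OF AB.guts_axioms _ N] AB.ground by simp
  interpret G: guts N C D S R
    using guts_extension[OF CD.guts_axioms _ ext] CD.ground by simp
  have sub: "C \<subseteq> ground M" "D \<subseteq> ground M" and q: "q \<notin> ground M"
    using CD.ground ext unfolding extension_def by auto
  have DB: "D \<subseteq> B" using AC CD.ground AB.ground by blast
  have eq: "local_conn N U V = local_conn M U V" if "U \<subseteq> ground M" "V \<subseteq> ground M" for U V
    using local_conn_extension[OF ext that] .
  have qC: "local_conn N (insert q C) V = local_conn N C V"
    "local_conn N V (insert q C) = local_conn N V C" for V
    using P.local_conn_insert_left P.conn_insert_right P.q_C[OF AC] by auto
  have "guts N (insert q C) D S R"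
    unfolding guts_def guts_axioms_def qC
    using P.matroid_axioms G.conn_CD G.Y_sub G.Z_sub G.conn_YD G.conn_CZ G.conn_YZ by blast
  moreover have "insert q C \<union> D = ground N" "insert q C \<inter> D = {}"
    using CD.ground q sub ext unfolding extension_def by auto
  moreover have "coherent N (insert q C) D S R"
    unfolding coherent_def qC
  proof (intro allI impI)
    fix F K assume F: "F \<subseteq> insert q C" "local_conn N F D = 1" and K: "K \<subseteq> D" "local_conn N C K = 1"
    \<comment> \<open>F is replaced by a set W of old elements that looks the same from D, and
      coherence in M is applied to W.\<close>
    have "\<exists>W \<subseteq> C. \<forall>V \<subseteq> D. local_conn N F V = local_conn N W V"
    proof (cases "q \<in> F")
      case False
      then show ?thesis using F by blast
    next
      case True
      let ?H = "F \<inter> B"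
      obtain W where W: "W \<subseteq> A" "\<And>V. V \<subseteq> B \<Longrightarrow> local_conn N (insert q (F \<inter> A)) V = local_conn N W V"
        using P.replace_point[of "F \<inter> A"] by auto
      have qB: "q \<notin> A \<union> B" using AB.ground q by simp
      have Feq: "F = insert q (F \<inter> A) \<union> ?H" using True F(1) sub AB.ground by auto
      \<comment> \<open>\<open>replace_point\<close> covers only the part of F in A together with q.
        The part H in B is restored by the identity conn(S \<union> H, V) = conn(S, H \<union> V) -
        conn(S, H) + conn(H, V), where H \<union> V lies in B.\<close>
      have "local_conn N F V = local_conn N (W \<union> ?H) V" if V: "V \<subseteq> D" for V
      proof -
        have "local_conn N (insert q (F \<inter> A)) ?H = local_conn N W ?H"
          "local_conn N (insert q (F \<inter> A)) (?H \<union> V) = local_conn N W (?H \<union> V)"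
          using W(2) V DB by auto
        then have "local_conn N (insert q (F \<inter> A) \<union> ?H) V = local_conn N (W \<union> ?H) V"
          unfolding local_conn_def Un_assoc by linarith
        then show ?thesis using Feq by simp
      qed
      moreover have "W \<union> ?H \<subseteq> C"
      proof -
        have "?H \<subseteq> C" using F(1) qB by auto
        then show ?thesis using W AC by blast
      qed
      ultimately show ?thesis by blast
    qed
    then obtain W where W: "W \<subseteq> C" "\<And>V. V \<subseteq> D \<Longrightarrow> local_conn N F V = local_conn N W V" by blast
    have Weq: "local_conn N F V = local_conn M W V" if "V \<subseteq> D" for V
      using W that eq[of W V] sub by auto
    have e: "local_conn N F D = local_conn M W D" "local_conn N F R = local_conn M W R"
      "local_conn N F K = local_conn M W K"
      using Weq K G.Z_sub by blast+
    have e': "local_conn N C K = local_conn M C K" "local_conn N S K = local_conn M S K"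
      using K(1) sub G.Y_sub by (intro eq; auto)+
    show "(local_conn N F R = 1 \<longrightarrow> local_conn N S K = 1 \<longrightarrow> local_conn N F K = 1) \<and>
        (local_conn N F K = 1 \<longrightarrow> (local_conn N F R = 1 \<longleftrightarrow> local_conn N S K = 1))"
      using CD.coherent W(1) F(2) K unfolding coherent_def e e' by blast
  qed
  ultimately have "coherent_guts N (insert q C) D S R"
    unfolding coherent_guts_def coherent_guts_axioms_def by blast
  moreover have "strand N (insert q C) D S" "strand N D (insert q C) R"
  proof -
    have st: "strand M C D S" "strand M D C R" using CD unfolding guts_system_def by auto
    have "local_conn N V D = local_conn M V D" if "V \<subseteq> S" for V
      using that sub G.Y_sub by (intro eq) auto
    then show "strand N (insert q C) D S" using st(1) unfolding strand_def by auto
    have "local_conn N V C = local_conn M V C" if "V \<subseteq> R" for V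
      using that sub G.Z_sub by (intro eq) auto
    then show "strand N D (insert q C) R" using st(2) unfolding strand_def qC by auto
  qed
  ultimately show ?thesis unfolding guts_system_def by blast
qed

section \<open>Noncrossing separations\<close>

text \<open>For two partitions of one set: some side of the first is disjoint from some side of the
  second. Containments are the form that \<open>grow\<close> preserves.\<close>

definition noncrossing :: "'a set \<Rightarrow> 'a set \<Rightarrow> 'a set \<Rightarrow> 'a set \<Rightarrow> bool" where
  "noncrossing A B C D \<longleftrightarrow> A \<subseteq> C \<or> A \<subseteq> D \<or> B \<subseteq> C \<or> B \<subseteq> D"

text \<open>A point \<open>q\<close> in the guts of \<open>(A, B)\<close> is put next to \<open>A\<close>: it joins the side of a noncrossing
  separation that contains \<open>A\<close>, or, if \<open>A\<close> meets both sides, the one that contains \<open>B\<close>.\<close>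

definition grow :: "'a set \<Rightarrow> 'a set \<Rightarrow> 'a \<Rightarrow> 'a set \<Rightarrow> 'a set" where
  "grow A B q S = (if A \<subseteq> S \<or> B \<subseteq> S \<and> A \<inter> S \<noteq> {} then insert q S else S)"

lemma grow_mono: "S \<subseteq> S' \<Longrightarrow> grow A B q S \<subseteq> grow A B q S'"
  unfolding grow_def by auto

lemma noncrossing_grow:
  "noncrossing C D C' D' \<Longrightarrow>
    noncrossing (grow A B q C) (grow A B q D) (grow A B q C') (grow A B q D')"
  unfolding noncrossing_def using grow_mono[of _ _ A B q] by meson

lemma guts_system_grow:
  assumes AB: "guts_system M A B Y Z" and N: "guts_extension M Y Z q N"
    and CD: "guts_system M C D S R" and nc: "noncrossing A B C D"
  shows "guts_system N (grow A B q C) (grow A B q D) S R"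
proof -
  interpret AB: coherent_guts M A B Y Z using AB unfolding guts_system_def by blast
  interpret CD: coherent_guts M C D S R using CD unfolding guts_system_def by blast
  note BA = guts_system_swap[OF AB] and N' = guts_extension_swap[OF N] and DC = guts_system_swap[OF CD]
  have ne: "A \<noteq> {}" "B \<noteq> {}" using AB.conn_CD AB.conn_empty by force+
  \<comment> \<open>Because A and B are nonempty, exactly one of C and D receives q, and it contains
    A or B.\<close>
  have "(A \<subseteq> C \<or> B \<subseteq> C) \<and> grow A B q C = insert q C \<and> grow A B q D = D \<or>
      (A \<subseteq> D \<or> B \<subseteq> D) \<and> grow A B q C = C \<and> grow A B q D = insert q D"
    using ne nc AB.ground CD.ground unfolding grow_def noncrossing_def by auto
  then show ?thesis
    using guts_system_insert[OF AB N CD] guts_system_insert[OF BA N' CD]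
      guts_system_insert[OF AB N DC] guts_system_insert[OF BA N' DC] guts_system_swap by metis
qed

text \<open>The matroid and the sides vary in the induction: once p i is added, the remaining
  systems live in the larger matroid on grown sides, with the same strands.\<close>

theorem ex1_noncrossing_extension:
  assumes "finite I" "matroid M"
    and "\<And>i. i \<in> I \<Longrightarrow> guts_system M (A i) (B i) (Y i) (Z i)"
    and "\<And>i j. i \<in> I \<Longrightarrow> j \<in> I \<Longrightarrow> noncrossing (A i) (B i) (A j) (B j)"
    and "inj_on p I" "p ` I \<inter> ground M = {}"
  shows "\<exists>!N. extension M (p ` I) N \<and>
    (\<forall>i \<in> I. circuit N (Y i \<union> {p i}) \<and> circuit N (Z i \<union> {p i}))"
  using assms
proof (induction I arbitrary: M A B rule: finite_induct)
  case empty
  then show ?case by (simp add: extension_empty)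
next
  case (insert i I)
  have sys: "guts_system M (A i) (B i) (Y i) (Z i)" and pi: "p i \<notin> ground M"
    using insert.prems by auto
  obtain N1 where N1: "guts_extension M (Y i) (Z i) (p i) N1"
    and uniq: "\<And>N. guts_extension M (Y i) (Z i) (p i) N \<Longrightarrow> N = N1"
    using ex1_guts_extension[OF sys pi] by metis
  have ext1: "extension M {p i} N1" using N1 unfolding guts_extension_def by blast
  let ?g = "grow (A i) (B i) (p i)"
  have piI: "p i \<notin> p ` I" using insert.prems(4) insert.hyps(2) by auto
  have "\<exists>!N. extension N1 (p ` I) N \<and>
    (\<forall>j \<in> I. circuit N (Y j \<union> {p j}) \<and> circuit N (Z j \<union> {p j}))"
  proof (rule insert.IH[of N1 "\<lambda>j. ?g (A j)" "\<lambda>j. ?g (B j)"])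
    show "matroid N1" using ext1 unfolding extension_def by blast
    show "guts_system N1 (?g (A j)) (?g (B j)) (Y j) (Z j)" if "j \<in> I" for j
      using that insert.prems by (intro guts_system_grow[OF sys N1]) auto
    show "noncrossing (?g (A j)) (?g (B j)) (?g (A k)) (?g (B k))" if "j \<in> I" "k \<in> I" for j k
      using that insert.prems by (intro noncrossing_grow) auto
    show "inj_on p I" using insert.prems by auto
    show "p ` I \<inter> ground N1 = {}"
      using insert.prems(5) piI ext1 unfolding extension_def by auto
  qed
  moreover have "extension M (p ` insert i I) N \<and>
      (\<forall>j \<in> insert i I. circuit N (Y j \<union> {p j}) \<and> circuit N (Z j \<union> {p j})) \<longleftrightarrow>
    extension N1 (p ` I) N \<and> (\<forall>j \<in> I. circuit N (Y j \<union> {p j}) \<and> circuit N (Z j \<union> {p j}))"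
    (is "?L \<longleftrightarrow> ?R") for N
  proof -
    interpret guts M "A i" "B i" "Y i" "Z i"
      using sys unfolding guts_system_def coherent_guts_def by blast
    have sub: "Y i \<union> {p i} \<subseteq> ground M \<union> {p i}" "Z i \<union> {p i} \<subseteq> ground M \<union> {p i}"
      using sys Y_sub Z_sub unfolding guts_system_def coherent_guts_def coherent_guts_axioms_def by auto
    show ?thesis
    proof
      assume R: ?R
      then have "extension M (p ` insert i I) N" using extension_trans[OF ext1, of "p ` I" N] by simp
      moreover have "ground N1 = ground M \<union> {p i}" using ext1 unfolding extension_def by simp
      then have "circuit N (Y i \<union> {p i})" "circuit N (Z i \<union> {p i})"
        using R N1 circuit_extension[of N1 "p ` I" N] sub unfolding guts_extension_def by auto
      ultimately show ?L using R by auto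
    next
      \<comment> \<open>Deleting all points but p i leaves an extension with the two required
        circuits, which must be \<open>N1\<close>.\<close>
      assume L: ?L
      then have "extension M ({p i} \<union> p ` I) N" by simp
      note split = extension_split[OF this]
      have s: "extension M {p i} (delete N (p ` I))" "extension (delete N (p ` I)) (p ` I) N"
        using split piI by auto
      have "ground (delete N (p ` I)) = ground M \<union> {p i}" using s(1) unfolding extension_def by simp
      then have "guts_extension M (Y i) (Z i) (p i) (delete N (p ` I))"
        using L s circuit_extension[OF s(2)] sub unfolding guts_extension_def by simp
      then have "delete N (p ` I) = N1" by (rule uniq)
      then show ?R using L s by auto
    qed
  qed
  ultimately show ?case by simp
qed

section \<open>Separations displayed by a tree\<close>

lemma equiv_connected_in: "equiv (nodes T) (connected_in T)"
proof (rule equivI)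
  have "sym {(x, y). {x, y} \<in> edges T}" by (auto intro!: symI simp: insert_commute)
  then have "sym ({(x, y). {x, y} \<in> edges T}\<^sup>*)" by (rule sym_rtrancl)
  then show "sym (connected_in T)" unfolding connected_in_def sym_def by blast
  show "trans (connected_in T)"
    unfolding connected_in_def trans_def by (auto intro: rtrancl_trans)
qed (auto simp: connected_in_def refl_on_def)

text \<open>Walks from a vertex of K in T - e stay in K, so they never use f and survive in T -
  f.\<close>

lemma component_avoiding_edge:
  assumes T: "simple_graph T" and K: "K \<in> components (delete_edge T e)" "K \<inter> f = {}"
  shows "\<exists>K' \<in> components (delete_edge T f). K \<subseteq> K'"
proof -
  obtain x where x: "x \<in> nodes T" "K = connected_in (delete_edge T e) `` {x}"
    using K(1) unfolding components_def quotient_def by (auto simp: delete_edge_def)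
  have "(x, y) \<in> connected_in (delete_edge T f)" if "y \<in> K" for y
  proof -
    have "(x, y) \<in> {(x, y). {x, y} \<in> edges (delete_edge T e)}\<^sup>*" and y: "y \<in> nodes T"
      using that x unfolding connected_in_def by (auto simp: delete_edge_def)
    then have "(x, y) \<in> {(x, y). {x, y} \<in> edges (delete_edge T f)}\<^sup>*"
    proof (induction rule: rtrancl_induct)
      case (step y z)
      have "y \<in> nodes T" using step.hyps(2) T unfolding simple_graph_def by (auto simp: delete_edge_def)
      then have "y \<in> K" using step.hyps(1) x unfolding connected_in_def by (auto simp: delete_edge_def)
      then have "{y, z} \<noteq> f" using K(2) by blast
      then have "(y, z) \<in> {(x, y). {x, y} \<in> edges (delete_edge T f)}"
        using step.hyps(2) by (auto simp: delete_edge_def)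
      moreover have "(x, y) \<in> {(x, y). {x, y} \<in> edges (delete_edge T f)}\<^sup>*"
        using step.IH \<open>y \<in> nodes T\<close> by blast
      ultimately show ?case by (rule rtrancl_into_rtrancl[rotated])
    qed simp
    then show ?thesis using x y unfolding connected_in_def by (simp add: delete_edge_def)
  qed
  then have "K \<subseteq> connected_in (delete_edge T f) `` {x}" by auto
  moreover have "connected_in (delete_edge T f) `` {x} \<in> components (delete_edge T f)"
    unfolding components_def using x(1) by (auto intro!: quotientI simp: delete_edge_def)
  ultimately show ?thesis by blast
qed

text \<open>f is still an edge of T - e, so both its ends lie in one component, and the other
  component misses it.\<close>

lemma edge_misses_component:
  assumes T: "simple_graph T" and f: "f \<in> edges T" "f \<noteq> e"
    and CD: "components (delete_edge T e) = {C, D}" "C \<noteq> D"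
  shows "C \<inter> f = {} \<or> D \<inter> f = {}"
proof -
  let ?R = "connected_in (delete_edge T e)"
  have eq: "equiv (nodes T) ?R" using equiv_connected_in[of "delete_edge T e"] by (simp add: delete_edge_def)
  have q: "C \<in> nodes T // ?R" "D \<in> nodes T // ?R"
    using CD unfolding components_def by (auto simp: delete_edge_def)
  obtain u v where uv: "f = {u, v}" using T f(1) unfolding simple_graph_def by (meson card_2_iff)
  have "u \<in> nodes T" "v \<in> nodes T" using T f(1) uv unfolding simple_graph_def by auto
  moreover have "{u, v} \<in> edges (delete_edge T e)" using f uv by (simp add: delete_edge_def)
  ultimately have uvR: "(u, v) \<in> ?R" unfolding connected_in_def by (auto simp: delete_edge_def)
  have "C \<inter> D = {}" using quotient_disj[OF eq q] CD(2) by blast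
  moreover have "u \<in> K \<longleftrightarrow> v \<in> K" if "K \<in> nodes T // ?R" for K
    using in_quotient_imp_closed[OF eq that _ uvR] in_quotient_imp_closed[OF eq that]
      uvR eq unfolding equiv_def sym_def by blast
  ultimately show ?thesis using q uv by blast
qed

lemma induced_partition_noncrossing:
  assumes "simple_graph T" "e \<in> edges T" "f \<in> edges T"
    and "e = f \<Longrightarrow> A = A' \<and> B = B'"
    and "induced_partition T X e A B" "induced_partition T X f A' B'"
  shows "noncrossing A B A' B'"
proof (cases "e = f")
  case True
  then show ?thesis using assms(4) unfolding noncrossing_def by blast
next
  case False
  obtain C D where CD: "C \<noteq> D" "components (delete_edge T e) = {C, D}"
    "A = \<Union> (X ` C)" "B = \<Union> (X ` D)"
    using assms(5) unfolding induced_partition_def by blast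
  obtain C' D' where CD': "components (delete_edge T f) = {C', D'}"
    "A' = \<Union> (X ` C')" "B' = \<Union> (X ` D')"
    using assms(6) unfolding induced_partition_def by blast
  have "(C \<subseteq> C' \<or> C \<subseteq> D') \<or> (D \<subseteq> C' \<or> D \<subseteq> D')"
    using edge_misses_component[OF assms(1,3) _ CD(2,1)] False
      component_avoiding_edge[OF assms(1), of C e f] component_avoiding_edge[OF assms(1), of D e f]
      CD(2) CD'(1) by auto
  then show ?thesis unfolding noncrossing_def CD(3,4) CD'(2,3) by blast
qed

lemma guts_if_strands:
  assumes "matroid M" "exact_3_separation M A B" "strand M A B Y" "strand M B A Z"
    and "local_conn M Y Z = 1"
  shows "guts M A B Y Z"
proof -
  have "local_conn M A B = 2"
    using assms(2) unfolding exact_3_separation_def local_conn_def by simp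
  then show ?thesis
    using assms unfolding guts_def guts_axioms_def strand_def by (simp add: local_conn_commute)
qed

theorem theorem4p1:
  fixes T :: "'v ugraph"
    and X :: "'v \<Rightarrow> 'a set"
    and M :: "'a matroid"
    and Y Z :: "'v set \<Rightarrow> 'a set"
    and m :: "'v set \<Rightarrow> nat"
    and Ys Zs :: "'v set \<Rightarrow> nat \<Rightarrow> 'a set"
    and p :: "'v set \<Rightarrow> nat \<Rightarrow> 'a"
  assumes "tree T"
    and "\<And>v. v \<in> nodes T \<Longrightarrow> X v \<noteq> {}"
    and "disjoint_family_on X (nodes T)"
    and "matroid M"
    and "ground M = (\<Union>v \<in> nodes T. X v)"
    and "\<And>e. e \<in> edges T \<Longrightarrow> induced_partition T X e (Y e) (Z e)"
    and "\<And>e. e \<in> edges T \<Longrightarrow> exact_3_separation M (Y e) (Z e)"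
    and "\<And>e k. e \<in> edges T \<Longrightarrow> k \<in> {1..m e} \<Longrightarrow> strand M (Y e) (Z e) (Ys e k)"
    and "\<And>e k. e \<in> edges T \<Longrightarrow> k \<in> {1..m e} \<Longrightarrow> strand M (Z e) (Y e) (Zs e k)"
    and "\<And>e k. e \<in> edges T \<Longrightarrow> k \<in> {1..m e} \<Longrightarrow> local_conn M (Ys e k) (Zs e k) = 1"
    and "\<And>e k. e \<in> edges T \<Longrightarrow> k \<in> {1..m e} \<Longrightarrow> p e k \<notin> ground M"
    and "inj_on (\<lambda>(e, k). p e k) (SIGMA e : edges T. {1..m e})"
    and "\<And>e k. e \<in> edges T \<Longrightarrow> k \<in> {1..m e} \<Longrightarrow>
      \<exists>N. extension M {p e k} N \<and> circuit N (Ys e k \<union> {p e k}) \<and> circuit N (Zs e k \<union> {p e k})"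
  shows "\<exists>!M'. extension M (\<Union>e \<in> edges T. p e ` {1..m e}) M' \<and>
    (\<forall>e \<in> edges T. \<forall>k \<in> {1..m e}.
      circuit M' (Ys e k \<union> {p e k}) \<and> circuit M' (Zs e k \<union> {p e k}))"
proof -
  let ?I = "SIGMA e : edges T. {1..m e}"
  let ?p = "\<lambda>(e, k). p e k" and ?Ys = "\<lambda>(e, k). Ys e k" and ?Zs = "\<lambda>(e, k). Zs e k"
  have T: "simple_graph T" using assms(1) unfolding tree_def by blast
  then have "edges T \<subseteq> Pow (nodes T)" "finite (nodes T)" unfolding simple_graph_def by auto
  then have "finite (edges T)" using finite_subset by blast
  then have fin: "finite ?I" by simp
  have sys: "guts_system M (Y (fst i)) (Z (fst i)) (?Ys i) (?Zs i)" if iI: "i \<in> ?I" for i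
  proof -
    obtain e k where i: "i = (e, k)" "e \<in> edges T" "k \<in> {1..m e}" using iI by (cases i) auto
    note strands = assms(8)[OF i(2,3)] assms(9)[OF i(2,3)]
    obtain N where N: "guts_extension M (Ys e k) (Zs e k) (p e k) N"
      using assms(13)[OF i(2,3)] unfolding guts_extension_def by blast
    have part: "Y e \<union> Z e = ground M" "Y e \<inter> Z e = {}"
      using assms(7)[OF i(2)] unfolding exact_3_separation_def by auto
    have "guts M (Y e) (Z e) (Ys e k) (Zs e k)"
      by (rule guts_if_strands[OF assms(4) assms(7)[OF i(2)] strands assms(10)[OF i(2,3)]])
    then have "coherent_guts M (Y e) (Z e) (Ys e k) (Zs e k)"
      using part N by (rule coherent_guts_if_extension)
    then show ?thesis using strands i unfolding guts_system_def by simp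
  qed
  \<comment> \<open>Points of the same edge share one partition, which does not cross
    itself.\<close>
  have nc: "noncrossing (Y (fst i)) (Z (fst i)) (Y (fst j)) (Z (fst j))"
    if "i \<in> ?I" "j \<in> ?I" for i j
    using that assms(6) by (intro induced_partition_noncrossing[OF T, of "fst i" "fst j"]) auto
  have new: "?p ` ?I \<inter> ground M = {}" using assms(11) by auto
  have "\<exists>!N. extension M (?p ` ?I) N \<and>
      (\<forall>i \<in> ?I. circuit N (?Ys i \<union> {?p i}) \<and> circuit N (?Zs i \<union> {?p i}))"
    by (rule ex1_noncrossing_extension[OF fin assms(4) sys nc assms(12) new])
  moreover have "?p ` ?I = (\<Union>e \<in> edges T. p e ` {1..m e})" by force
  moreover have "(\<forall>i \<in> ?I. circuit N (?Ys i \<union> {?p i}) \<and> circuit N (?Zs i \<union> {?p i})) \<longleftrightarrow>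
      (\<forall>e \<in> edges T. \<forall>k \<in> {1..m e}. circuit N (Ys e k \<union> {p e k}) \<and> circuit N (Zs e k \<union> {p e k}))" for N
    by auto
  ultimately show ?thesis by simp
qed

end
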